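(* There exist four families $\mathcal{C}_1,\mathcal{C}_2,\mathcal{B}_1,\mathcal{B}_2$ of subfields $K$ of $\mathbb{R}$ with $\overline{K}=\mathbb{C}$ such that $|\mathcal{C}_1|=|\mathcal{C}_2|=|\mathcal{B}_1|=|\mathcal{B}_2|=2^{\mathbf{c}}$, all fields in $\mathcal{C}_1\cup\mathcal{C}_2$ are Cantor fields, all fields in $\mathcal{B}_1\cup\mathcal{B}_2$ are Bernstein fields, all fields in $\mathcal{C}_1\cup\mathcal{B}_1$ are isomorphic to each other, whereas the fields in $\mathcal{C}_2\cup\mathcal{B}_2$ are incomparable.
   Context: $\mathbf{c}=2^{\aleph_0}=|\mathbb{R}|$. For a subfield $K$ of $\mathbb{R}$, $\overline{K}$ denotes the algebraic closure of $K$ (taken inside $\mathbb{C}$), so $\overline{K}=\mathbb{C}$ means that $\mathbb{R}$ is an algebraic extension of $K$. A nonempty set $C\subset\mathbb{R}$ is a Cantor set if it is compact and contains neither nondegenerate intervals nor isolated points (isolated relative to $C$). A Cantor field is a proper subfield of $\mathbb{R}$ that contains some Cantor set as a subset. A set $B\subset\mathbb{R}$ is a Bernstein set if neither $B$ nor $\mathbb{R}\setminus B$ contains a Cantor set. A Bernstein field is a subfield of $\mathbb{R}$ which is a Bernstein set. The fields in a collection are called incomparable if no field in the collection is isomorphic to a subfield of another (distinct) field in the collection. *)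

theory Defs
  imports
    "HOL-Analysis.Analysis"
    "HOL-Library.Equipollence"
    "HOL-Algebra.Algebraic_Closure_Type"
begin

abbreviation real_ring :: "real ring" where
  "real_ring \<equiv> ring_of_type_algebra"

abbreviation complex_ring :: "complex ring" where
  "complex_ring \<equiv> ring_of_type_algebra"

definition alg_closure_in_complex :: "real set \<Rightarrow> complex set" where
  "alg_closure_in_complex K =
     {z. (ring.algebraic complex_ring over (complex_of_real ` K)) z}"

(* A nondegenerate interval of any kind (open, half-open, unbounded) contains
   a nondegenerate closed one, so closed intervals suffice here. *)
definition cantor_set :: "real set \<Rightarrow> bool" where
  "cantor_set C \<longleftrightarrow>
     C \<noteq> {} \<and> compact C \<and> \<not> (\<exists>a b. a < b \<and> {a..b} \<subseteq> C) \<and> \<not> (\<exists>x. x isolated_in C)"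

definition cantor_field :: "real set \<Rightarrow> bool" where
  "cantor_field K \<longleftrightarrow>
     subfield K real_ring \<and> K \<noteq> UNIV \<and> (\<exists>C. cantor_set C \<and> C \<subseteq> K)"

definition bernstein_set :: "real set \<Rightarrow> bool" where
  "bernstein_set B \<longleftrightarrow>
     \<not> (\<exists>C. cantor_set C \<and> C \<subseteq> B) \<and> \<not> (\<exists>C. cantor_set C \<and> C \<subseteq> - B)"

definition bernstein_field :: "real set \<Rightarrow> bool" where
  "bernstein_field K \<longleftrightarrow> subfield K real_ring \<and> bernstein_set K"

(* Isomorphisms are abstract ring isomorphisms; no continuity or order
   preservation is required. *)
definition isomorphic_fields :: "real set \<Rightarrow> real set \<Rightarrow> bool" where
  "isomorphic_fields K L \<longleftrightarrow>
     real_ring\<lparr>carrier := K\<rparr> \<simeq> real_ring\<lparr>carrier := L\<rparr>"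

definition incomparable_fields :: "real set set \<Rightarrow> bool" where
  "incomparable_fields F \<longleftrightarrow>
     (\<forall>K\<in>F. \<forall>L\<in>F. K \<noteq> L \<longrightarrow>
        \<not> (\<exists>M. subfield M (real_ring\<lparr>carrier := L\<rparr>) \<and> isomorphic_fields K M))"

end

theory Submission
  imports Defs
begin

text \<open>Let \<open>A \<union> Y \<union> {r}\<close> be an algebraically independent set of reals (disjoint union) with
  \<open>|Y|\<close> the continuum, where \<open>A\<close> is a Cantor set or meets every Cantor set. For \<open>S \<subseteq> Y\<close> put
  \<open>U\<^sub>S = A \<union> {r\<^sup>3} \<union> (Y - S) \<union> {t r | t \<in> S}\<close>; this set is again independent, and a field that
  contains \<open>U\<^sub>S\<close> and \<open>U\<^sub>S'\<close> with \<open>S \<noteq> S'\<close> contains \<open>r\<close>. Extending \<open>U\<^sub>S\<close> to a transcendence basis \<open>T\<^sub>S\<close>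
  gives purely transcendental fields \<open>\<rat>(T\<^sub>S)\<close> that avoid \<open>r\<close> and hence are distinct; they are all
  isomorphic. Extending \<open>\<rat>(U\<^sub>S)\<close> instead to a field \<open>K\<^sub>S\<close> maximal among the subfields of \<open>\<real>\<close>
  avoiding \<open>r\<close> gives fields that are closed under square roots of positive elements, because a real
  quadratic extension does not create cube roots. The order of such a field is determined
  algebraically, so its only embedding into \<open>\<real>\<close> is the inclusion, and maximality makes the \<open>K\<^sub>S\<close>
  incomparable. A proper subfield that meets every Cantor set is Bernstein, since a Cantor set
  inside it could be translated off it; this also excludes inclusions between Cantor and Bernstein
  fields in both directions.\<close>


section \<open>Integer polynomial expressions\<close>

text \<open>Syntax trees for polynomials with integer coefficients. Different trees may denote the
  same polynomial; in exchange renaming, substitution and counting become structural.\<close>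

datatype (vars: 'a) pexpr =
    PConst int
  | PVar 'a
  | PAdd "'a pexpr" "'a pexpr"
  | PMul "'a pexpr" "'a pexpr"
  for map: map_pexpr

instance pexpr :: (countable) countable
  by countable_datatype

primrec ev :: "('a \<Rightarrow> real) \<Rightarrow> 'a pexpr \<Rightarrow> real" where
  "ev v (PConst c) = of_int c"
| "ev v (PVar i) = v i"
| "ev v (PAdd p q) = ev v p + ev v q"
| "ev v (PMul p q) = ev v p * ev v q"

primrec subst :: "('a \<Rightarrow> 'b pexpr) \<Rightarrow> 'a pexpr \<Rightarrow> 'b pexpr" where
  "subst s (PConst c) = PConst c"
| "subst s (PVar i) = s i"
| "subst s (PAdd p q) = PAdd (subst s p) (subst s q)"
| "subst s (PMul p q) = PMul (subst s p) (subst s q)"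

definition PSub :: "'a pexpr \<Rightarrow> 'a pexpr \<Rightarrow> 'a pexpr" where
  "PSub p q = PAdd p (PMul (PConst (-1)) q)"

lemma vars_PSub [simp]: "vars (PSub p q) = vars p \<union> vars q"
  by (simp add: PSub_def)

lemma ev_PSub [simp]: "ev v (PSub p q) = ev v p - ev v q"
  by (simp add: PSub_def)

lemma finite_vars [simp]: "finite (vars p)"
  by (induction p) auto

lemma ev_cong: "(\<And>i. i \<in> vars p \<Longrightarrow> v i = w i) \<Longrightarrow> ev v p = ev w p"
  by (induction p) auto

lemma ev_map: "ev v (map_pexpr f p) = ev (\<lambda>i. v (f i)) p"
  by (induction p) auto

lemma ev_subst: "ev v (subst s p) = ev (\<lambda>i. ev v (s i)) p"
  by (induction p) auto

lemma vars_subst: "vars (subst s p) = (\<Union>i\<in>vars p. vars (s i))"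
  by (induction p) auto

lemma tendsto_ev:
  assumes "\<And>i. i \<in> vars p \<Longrightarrow> ((\<lambda>n. w n i) \<longlongrightarrow> v i) F"
  shows "((\<lambda>n. ev (w n) p) \<longlongrightarrow> ev v p) F"
  using assms by (induction p) (auto intro!: tendsto_intros)

text \<open>As \<open>\<real>\<close> is infinite, a polynomial is nonzero iff it is nonzero as a function; this stands in
  for a type of formal multivariate polynomials.\<close>

definition nontrivial :: "'a pexpr \<Rightarrow> bool" where
  "nontrivial p \<longleftrightarrow> (\<exists>v. ev v p \<noteq> 0)"

text \<open>Supplies the convolution sums that serve as coefficients of a product in
  \<open>expand_variable\<close>.\<close>

lemma sum_pexpr:
  fixes f :: "nat \<Rightarrow> 'a pexpr"
  shows "\<exists>q. vars q \<subseteq> (\<Union>j<n. vars (f j)) \<and> (\<forall>v. ev v q = (\<Sum>j<n. ev v (f j)))"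
proof (induction n)
  case 0
  show ?case by (rule exI[of _ "PConst 0"]) auto
next
  case (Suc n)
  then obtain q where "vars q \<subseteq> (\<Union>j<n. vars (f j))" "\<forall>v. ev v q = (\<Sum>j<n. ev v (f j))"
    by blast
  then show ?case
    by (intro exI[of _ "PAdd q (f n)"]) (auto simp: lessThan_Suc)
qed

text \<open>Reads \<open>p\<close> as a polynomial in the single variable \<open>i\<close> whose
  \<open>k\<close>-th coefficient is the expression \<open>c k\<close> in the other variables. Only
  values are compared, so \<open>P\<close> depends on the assignment \<open>v\<close>.\<close>

definition expands :: "(nat \<Rightarrow> 'a pexpr) \<Rightarrow> 'a \<Rightarrow> 'a pexpr \<Rightarrow> bool" where
  "expands c i p \<longleftrightarrow> (\<forall>k. vars (c k) \<subseteq> vars p - {i}) \<and>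
     (\<forall>v. \<exists>P. (\<forall>k. poly.coeff P k = ev v (c k)) \<and> (\<forall>x. ev (v(i := x)) p = poly P x))"

lemma expandsI:
  assumes "\<And>k. vars (c k) \<subseteq> vars p - {i}"
    and "\<And>v k. poly.coeff (P v) k = ev v (c k)" "\<And>v x. ev (v(i := x)) p = poly (P v) x"
  shows "expands c i p"
  using assms unfolding expands_def by blast

lemma expandsE:
  assumes "expands c i p"
  obtains P where "\<And>v k. poly.coeff (P v) k = ev v (c k)" "\<And>v x. ev (v(i := x)) p = poly (P v) x"
  using assms unfolding expands_def by metis

lemma expand_variable: "\<exists>c. expands c i p"
proof (induction p)
  case (PConst n)
  show ?case
    by (rule exI, rule expandsI[where P = "\<lambda>v. [:of_int n:]" and c = "\<lambda>k. if k = 0 then PConst n else PConst 0"])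
      (auto simp: coeff_pCons split: nat.splits)
next
  case (PVar j)
  show ?case
  proof (cases "j = i")
    case True
    show ?thesis
      by (rule exI, rule expandsI[where P = "\<lambda>v. [:0, 1:]" and c = "\<lambda>k. if k = 1 then PConst 1 else PConst 0"])
        (auto simp: coeff_pCons True split: nat.splits)
  next
    case False
    then show ?thesis
      by (intro exI) (rule expandsI[where P = "\<lambda>v. [:v j:]" and c = "\<lambda>k. if k = 0 then PVar j else PConst 0"],
          auto simp: coeff_pCons split: nat.splits)
  qed
next
  case (PAdd p q)
  then obtain c d where cd: "expands c i p" "expands d i q" by blast
  from cd(1) obtain P where P:
      "\<And>v k. poly.coeff (P v) k = ev v (c k)" "\<And>v x. ev (v(i := x)) p = poly (P v) x"
    by (rule expandsE) (rule that)
  from cd(2) obtain Q where Q: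
      "\<And>v k. poly.coeff (Q v) k = ev v (d k)" "\<And>v x. ev (v(i := x)) q = poly (Q v) x"
    by (rule expandsE) (rule that)
  have "vars (c k) \<subseteq> vars p - {i}" "vars (d k) \<subseteq> vars q - {i}" for k
    using cd by (auto simp: expands_def)
  then have "expands (\<lambda>k. PAdd (c k) (d k)) i (PAdd p q)"
    by (intro expandsI[where P = "\<lambda>v. P v + Q v"]) (auto simp: P Q dest: subsetD)
  then show ?case by blast
next
  case (PMul p q)
  then obtain c d where cd: "expands c i p" "expands d i q" by blast
  from cd(1) obtain P where P:
      "\<And>v k. poly.coeff (P v) k = ev v (c k)" "\<And>v x. ev (v(i := x)) p = poly (P v) x"
    by (rule expandsE) (rule that)
  from cd(2) obtain Q where Q:
      "\<And>v k. poly.coeff (Q v) k = ev v (d k)" "\<And>v x. ev (v(i := x)) q = poly (Q v) x"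
    by (rule expandsE) (rule that)
  have "\<exists>r. vars r \<subseteq> (\<Union>j<Suc k. vars (PMul (c j) (d (k - j)))) \<and>
          (\<forall>v. ev v r = (\<Sum>j<Suc k. ev v (PMul (c j) (d (k - j)))))" for k
    by (rule sum_pexpr)
  then obtain r where r: "\<And>k. vars (r k) \<subseteq> (\<Union>j<Suc k. vars (PMul (c j) (d (k - j))))"
      "\<And>k v. ev v (r k) = (\<Sum>j<Suc k. ev v (PMul (c j) (d (k - j))))"
    by metis
  have "expands r i (PMul p q)"
  proof (rule expandsI[where P = "\<lambda>v. P v * Q v"])
    fix k
    have "vars (PMul (c j) (d (k - j))) \<subseteq> vars (PMul p q) - {i}" for j
      using cd by (auto simp: expands_def dest: subsetD)
    then show "vars (r k) \<subseteq> vars (PMul p q) - {i}"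
      using r(1)[of k] by blast
  next
    fix v k
    show "poly.coeff (P v * Q v) k = ev v (r k)"
      unfolding r(2) coeff_mult lessThan_Suc_atMost by (simp add: P Q)
  qed (simp add: P Q)
  then show ?case by blast
qed

text \<open>Moves the variables into their sets one at a time: with the others fixed, a nonzero
  univariate polynomial has only finitely many roots to avoid.\<close>

lemma nontrivial_nonzero:
  assumes "nontrivial p" and inf: "\<And>i. infinite (A i :: real set)"
  obtains w where "\<And>i. w i \<in> A i" "ev w p \<noteq> 0"
proof -
  have "\<exists>w. (\<forall>i\<in>I. w i \<in> A i) \<and> ev w p \<noteq> 0" if "finite I" for I
    using that
  proof (induction I)
    case empty
    then show ?case using assms(1) by (simp add: nontrivial_def)
  next
    case (insert i I)
    then obtain w where w: "\<forall>i\<in>I. w i \<in> A i" "ev w p \<noteq> 0" by blast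
    obtain P where P: "\<forall>x. ev (w(i := x)) p = poly P x"
      using expand_variable[of i p] unfolding expands_def by meson
    have "P \<noteq> 0"
      using w(2) P[rule_format, of "w i"] by auto
    then have "finite {x. poly P x = 0}"
      by (rule poly_roots_finite)
    then obtain x where "x \<in> A i" "poly P x \<noteq> 0"
      using inf[of i] by (metis (mono_tags, lifting) finite_subset mem_Collect_eq subsetI)
    then have "ev (w(i := x)) p \<noteq> 0" using P by simp
    moreover have "\<forall>j\<in>insert i I. (w(i := x)) j \<in> A j"
      using \<open>x \<in> A i\<close> w(1) by simp
    ultimately show ?case by blast
  qed
  from this[of "vars p"] obtain w where w: "\<forall>i\<in>vars p. w i \<in> A i" "ev w p \<noteq> 0"
    by auto
  have "\<exists>x. x \<in> A i" for i using inf[of i] by (metis all_not_in_conv finite.emptyI)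
  then obtain a where a: "\<And>i. a i \<in> A i" by metis
  let ?w = "\<lambda>i. if i \<in> vars p then w i else a i"
  have "ev ?w p = ev w p" by (rule ev_cong) auto
  with w a show thesis by (intro that[of ?w]) auto
qed



section \<open>Subfields of the reals and their embeddings\<close>

text \<open>The convention \<open>inverse 0 = 0\<close> allows closure under inverses to be stated
  without an exception for zero.\<close>

definition real_subfield :: "real set \<Rightarrow> bool" where
  "real_subfield K \<longleftrightarrow>
     1 \<in> K \<and> (\<forall>x\<in>K. inverse x \<in> K) \<and> (\<forall>x\<in>K. \<forall>y\<in>K. x - y \<in> K \<and> x * y \<in> K)"

context
  fixes K assumes K: "real_subfield K"
begin

lemma real_subfield_1: "1 \<in> K"
  using K by (auto simp: real_subfield_def)

lemma real_subfield_diff: "x \<in> K \<Longrightarrow> y \<in> K \<Longrightarrow> x - y \<in> K"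
  using K by (auto simp: real_subfield_def)

lemma real_subfield_mult: "x \<in> K \<Longrightarrow> y \<in> K \<Longrightarrow> x * y \<in> K"
  using K by (auto simp: real_subfield_def)

lemma real_subfield_inverse: "x \<in> K \<Longrightarrow> inverse x \<in> K"
  using K by (auto simp: real_subfield_def)

lemma real_subfield_0: "0 \<in> K"
  using real_subfield_diff[OF real_subfield_1 real_subfield_1] by simp

lemma real_subfield_minus: "x \<in> K \<Longrightarrow> - x \<in> K"
  using real_subfield_diff[OF real_subfield_0] by fastforce

lemma real_subfield_add: "x \<in> K \<Longrightarrow> y \<in> K \<Longrightarrow> x + y \<in> K"
  using real_subfield_diff[OF _ real_subfield_minus, of x y] by simp

lemma real_subfield_divide: "x \<in> K \<Longrightarrow> y \<in> K \<Longrightarrow> x / y \<in> K"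
  unfolding divide_inverse by (intro real_subfield_mult real_subfield_inverse)

lemma real_subfield_power: "x \<in> K \<Longrightarrow> x ^ n \<in> K"
  by (induction n) (auto intro: real_subfield_1 real_subfield_mult)

lemma real_subfield_sum: "(\<And>i. i \<in> A \<Longrightarrow> f i \<in> K) \<Longrightarrow> sum f A \<in> K"
  by (induction A rule: infinite_finite_induct) (auto intro: real_subfield_0 real_subfield_add)

lemma real_subfield_of_nat: "of_nat n \<in> K"
  by (induction n) (auto intro: real_subfield_0 real_subfield_1 real_subfield_add)

lemma real_subfield_of_int: "of_int n \<in> K"
  by (cases n rule: int_cases2) (auto intro: real_subfield_of_nat real_subfield_minus)

lemmas real_subfield_intros = real_subfield_0 real_subfield_1 real_subfield_diff real_subfield_mult
  real_subfield_inverse real_subfield_minus real_subfield_add real_subfield_divide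
  real_subfield_power real_subfield_of_nat real_subfield_of_int

end

section \<open>Translation to carrier-based rings\<close>

lemma ring_of_type_algebra_simps [simp]:
  "carrier ring_of_type_algebra = UNIV"
  "monoid.mult ring_of_type_algebra x y = x * y"
  "ring.add ring_of_type_algebra x y = x + y"
  "one ring_of_type_algebra = 1"
  "ring.zero ring_of_type_algebra = 0"
  by (simp_all add: ring_of_type_algebra_def)

lemma subfield_ring_of_type_algebra:
  fixes K :: "'a :: field set"
  assumes 1: "1 \<in> K" and i: "\<And>x. x \<in> K \<Longrightarrow> inverse x \<in> K"
    and d: "\<And>x y. x \<in> K \<Longrightarrow> y \<in> K \<Longrightarrow> x - y \<in> K"
    and m: "\<And>x y. x \<in> K \<Longrightarrow> y \<in> K \<Longrightarrow> x * y \<in> K"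
  shows "subfield K (ring_of_type_algebra :: 'a ring)"
proof -
  interpret R: field "ring_of_type_algebra :: 'a ring"
    by (rule field_from_type_algebra)
  have 0: "0 \<in> K" using d[OF 1 1] by simp
  have minus: "a_inv ring_of_type_algebra x = - x" for x :: 'a
    by (rule R.minus_equality) simp_all
  have neg: "- x \<in> K" if "x \<in> K" for x using d[OF 0 that] by simp
  have inv: "m_inv ring_of_type_algebra x = inverse x" if "x \<noteq> 0" for x :: 'a
    by (rule R.comm_inv_char[symmetric, THEN sym]) (use that in simp_all)
  show ?thesis
  proof (rule R.subfieldI'[OF R.subringI])
    fix x y assume "x \<in> K" "y \<in> K"
    then show "x \<oplus>\<^bsub>ring_of_type_algebra\<^esub> y \<in> K"
      using d[OF _ neg, of x y] by simp
  qed (use 1 i m neg minus inv in auto)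
qed

lemma subfield_real_ring: "real_subfield K \<Longrightarrow> subfield K real_ring"
  by (rule subfield_ring_of_type_algebra) (auto simp: real_subfield_def)

section \<open>Algebraic elements and the algebraic closure in the complex numbers\<close>

definition algebraic_over :: "real set \<Rightarrow> real \<Rightarrow> bool" where
  "algebraic_over K x \<longleftrightarrow> (\<exists>P. P \<noteq> 0 \<and> (\<forall>k. poly.coeff P k \<in> K) \<and> poly P x = 0)"

text \<open>Polynomials over carrier-based rings are lists with the leading coefficient first, hence
  the reversal.\<close>

lemma eval_rev_coeffs: "ring.eval complex_ring (rev (Polynomial.coeffs Q)) x = poly Q x"
proof -
  interpret CC: field complex_ring
    by (rule field_from_type_algebra)
  show ?thesis
  proof (induction Q)
    case (pCons a Q)
    then show ?case
      by (auto simp: cCons_def CC.eval_append_aux)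
  qed simp
qed

lemma algebraic_complex_ring:
  fixes K :: "complex set"
  assumes "Q \<noteq> 0" "\<And>k. poly.coeff Q k \<in> K" "poly Q x = 0"
  shows "(ring.algebraic complex_ring over K) x"
proof -
  interpret CC: field complex_ring
    by (rule field_from_type_algebra)
  show ?thesis
  proof (rule CC.algebraicI)
    show "rev (Polynomial.coeffs Q) \<noteq> []" using assms(1) by simp
    show "CC.eval (rev (Polynomial.coeffs Q)) x = \<zero>\<^bsub>complex_ring\<^esub>"
      using assms(3) by (simp add: eval_rev_coeffs)
    have "set (Polynomial.coeffs Q) \<subseteq> K"
      using assms(2) by (auto simp: Polynomial.coeffs_def)
    moreover have "hd (rev (Polynomial.coeffs Q)) \<noteq> 0"
      using assms(1) by (simp add: hd_rev last_coeffs_eq_coeff_degree)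
    ultimately show "rev (Polynomial.coeffs Q) \<in> carrier (K[X]\<^bsub>complex_ring\<^esub>)"
      by (simp add: univ_poly_def polynomial_def)
  qed
qed

text \<open>The complex numbers algebraic over \<open>K\<close> form a subfield; it contains all
  reals by \<open>alg\<close> and also the imaginary unit, hence everything.\<close>

lemma alg_closure_in_complex_eq_UNIV:
  assumes K: "real_subfield K" and alg: "\<And>x. algebraic_over K x"
  shows "alg_closure_in_complex K = UNIV"
proof -
  interpret CC: field complex_ring
    by (rule field_from_type_algebra)
  let ?K = "complex_of_real ` K"
  let ?A = "{z \<in> carrier complex_ring. (ring.algebraic complex_ring over ?K) z}"
  have "subfield ?K complex_ring"
  proof (rule subfield_ring_of_type_algebra)
    show "1 \<in> ?K" using real_subfield_1[OF K] by (metis image_eqI of_real_1)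
    fix x assume "x \<in> ?K"
    then show "inverse x \<in> ?K" using real_subfield_inverse[OF K] by (auto simp flip: of_real_inverse)
    fix y assume "y \<in> ?K"
    show "x - y \<in> ?K" "x * y \<in> ?K"
      using \<open>x \<in> ?K\<close> \<open>y \<in> ?K\<close> real_subfield_diff[OF K] real_subfield_mult[OF K]
      by (auto simp flip: of_real_diff of_real_mult)
  qed
  then have "subfield ?A complex_ring"
    by (rule CC.subfield_of_algebraics)
  then have sr: "subring ?A complex_ring"
    by (rule subfieldE(1))
  have real: "complex_of_real x \<in> ?A" for x
  proof -
    have poly_of_real: "poly (map_poly complex_of_real P) (complex_of_real x) = of_real (poly P x)" for P
      by (induction P) (auto simp: map_poly_pCons)
    obtain P where P: "P \<noteq> 0" "\<forall>k. poly.coeff P k \<in> K" "poly P x = 0"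
      using alg unfolding algebraic_over_def by blast
    have "(ring.algebraic complex_ring over ?K) (complex_of_real x)"
    proof (rule algebraic_complex_ring)
      show "map_poly complex_of_real P \<noteq> 0" using P(1) by (simp add: map_poly_eq_0_iff)
      show "poly.coeff (map_poly complex_of_real P) k \<in> ?K" for k
        using P(2) by (simp add: coeff_map_poly)
      show "poly (map_poly complex_of_real P) (complex_of_real x) = 0"
        using P(3) poly_of_real by (metis of_real_0)
    qed
    then show ?thesis by simp
  qed
  have "(ring.algebraic complex_ring over ?K) \<i>"
  proof (rule algebraic_complex_ring)
    have "0 \<in> ?K" "1 \<in> ?K"
      using real_subfield_0[OF K] real_subfield_1[OF K] by (force)+
    then show "poly.coeff [:1, 0, 1:] k \<in> ?K" for k
      by (auto simp: coeff_pCons split: nat.splits)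
  qed auto
  then have i: "\<i> \<in> ?A" by simp
  have "z \<in> ?A" for z
  proof -
    have "complex_of_real (Im z) * \<i> \<in> ?A"
      using subringE(6)[OF sr real[of "Im z"] i] by simp
    then have "complex_of_real (Re z) + complex_of_real (Im z) * \<i> \<in> ?A"
      using subringE(7)[OF sr real[of "Re z"]] by simp
    then show ?thesis by (metis complex_eq mult.commute)
  qed
  then show ?thesis
    unfolding alg_closure_in_complex_def by blast
qed

section \<open>Isomorphisms between subfields of the reals\<close>

lemma isomorphic_fieldsI:
  assumes "bij_betw h K L" "h 1 = 1"
    and "\<And>x y. x \<in> K \<Longrightarrow> y \<in> K \<Longrightarrow> h (x + y) = h x + h y"
    and "\<And>x y. x \<in> K \<Longrightarrow> y \<in> K \<Longrightarrow> h (x * y) = h x * h y"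
  shows "isomorphic_fields K L"
proof -
  have "h \<in> ring_iso (real_ring\<lparr>carrier := K\<rparr>) (real_ring\<lparr>carrier := L\<rparr>)"
    unfolding ring_iso_def using assms by (auto intro!: ring_hom_memI dest: bij_betwE)
  then show ?thesis
    unfolding isomorphic_fields_def is_ring_iso_def by blast
qed

lemma isomorphic_fieldsE:
  assumes "isomorphic_fields K L"
  obtains h where "bij_betw h K L" "h 1 = 1"
    "\<And>x y. x \<in> K \<Longrightarrow> y \<in> K \<Longrightarrow> h (x + y) = h x + h y"
    "\<And>x y. x \<in> K \<Longrightarrow> y \<in> K \<Longrightarrow> h (x * y) = h x * h y"
proof -
  obtain h where h: "h \<in> ring_hom (real_ring\<lparr>carrier := K\<rparr>) (real_ring\<lparr>carrier := L\<rparr>)" "bij_betw h K L"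
    using assms unfolding isomorphic_fields_def is_ring_iso_def ring_iso_def by auto
  show thesis
    using ring_hom_add[OF h(1)] ring_hom_mult[OF h(1)] ring_hom_one[OF h(1)]
    by (intro that[OF h(2)]) auto
qed

text \<open>Squares characterise positivity in \<open>K\<close>, so an isomorphism preserves the
  order; since it also fixes the rationals, density makes it the identity. This is the rigidity
  behind incomparability.\<close>

lemma isomorphic_fields_square_root_closed:
  assumes K: "real_subfield K" and iso: "isomorphic_fields K M"
    and sqrt: "\<And>d. d \<in> K \<Longrightarrow> d > 0 \<Longrightarrow> sqrt d \<in> K"
  shows "M = K"
proof -
  obtain h where h: "bij_betw h K M" "h 1 = 1"
    and add: "\<And>x y. x \<in> K \<Longrightarrow> y \<in> K \<Longrightarrow> h (x + y) = h x + h y"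
    and mult: "\<And>x y. x \<in> K \<Longrightarrow> y \<in> K \<Longrightarrow> h (x * y) = h x * h y"
    by (rule isomorphic_fieldsE[OF iso]) (rule that)
  note intros = real_subfield_intros[OF K]
  have h0: "h 0 = 0" using add[OF intros(1) intros(1)] by simp
  have minus: "h (- x) = - h x" if "x \<in> K" for x
    using add[OF that intros(6)[OF that]] h0 by simp
  have diff: "h (x - y) = h x - h y" if "x \<in> K" "y \<in> K" for x y
    using add[OF that(1) intros(6)[OF that(2)]] minus[OF that(2)] by simp
  have nat: "h (of_nat n) = of_nat n" for n
    by (induction n) (simp_all add: h0 h(2) add intros)
  have int: "h (of_int n) = of_int n" for n
    by (cases n rule: int_cases2) (simp_all add: nat minus intros)
  \<comment> \<open>\<open>h d\<close> is the square of the real number \<open>h (sqrt d)\<close>,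
    and injectivity excludes zero.\<close>
  have pos: "h d > 0" if "d \<in> K" "d > 0" for d
  proof -
    have "h d = h (sqrt d) ^ 2"
      using mult[OF sqrt[OF that] sqrt[OF that]] that(2) by (simp add: power2_eq_square)
    moreover have "h d \<noteq> 0"
      using bij_betw_imp_inj_on[OF h(1)] that h0 intros(1) by (metis inj_onD less_irrefl)
    ultimately show ?thesis by simp
  qed
  have mono: "h x < h y" if "x \<in> K" "y \<in> K" "x < y" for x y
    using pos[OF intros(3)[OF that(2,1)]] diff[OF that(2,1)] that(3) by simp
  have rat: "h q = q" if "q \<in> \<rat>" for q
  proof -
    obtain a b where ab: "q = of_int a / of_int b" "b > 0"
      using \<open>q \<in> \<rat>\<close> by (metis Rats_cases')
    have "q * of_int b = of_int a" using ab by simp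
    moreover have "h (q * of_int b) = h q * of_int b"
      using mult[OF intros(8)[OF intros(11) intros(11)] intros(11), of a b b] ab by (simp add: int)
    ultimately have "h q * of_int b = q * of_int b" using int by metis
    then show ?thesis using ab(2) by simp
  qed
  have ratK: "q \<in> K" if "q \<in> \<rat>" for q
    using that by (metis Rats_cases' intros(8) intros(11))
  \<comment> \<open>A rational strictly between \<open>x\<close> and \<open>h x\<close> would be
    fixed by \<open>h\<close>, against monotonicity.\<close>
  have "h x = x" if "x \<in> K" for x
  proof (rule ccontr)
    assume "h x \<noteq> x"
    then consider "h x < x" | "x < h x" by linarith
    then show False
    proof cases
      case 1
      then obtain q where "q \<in> \<rat>" "h x < q" "q < x" using Rats_dense_in_real by blast
      then show False using mono[OF ratK that, of q] rat by fastforce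
    next
      case 2
      then obtain q where "q \<in> \<rat>" "x < q" "q < h x" using Rats_dense_in_real by blast
      then show False using mono[OF that ratK, of q] rat by fastforce
    qed
  qed
  then have "h ` K = K" by force
  then show ?thesis using h(1) by (simp add: bij_betw_def)
qed



section \<open>Algebraic independence\<close>

text \<open>Algebraic independence over the rationals; clearing denominators reduces this to integer
  coefficients. A family indexed by \<open>I\<close>, rather than a set, permits renaming and
  substitution; independence forces \<open>v\<close> to be injective on \<open>I\<close>.\<close>

definition indep :: "('a \<Rightarrow> real) \<Rightarrow> 'a set \<Rightarrow> bool" where
  "indep v I \<longleftrightarrow> (\<forall>p. vars p \<subseteq> I \<longrightarrow> nontrivial p \<longrightarrow> ev v p \<noteq> 0)"

abbreviation indep_set :: "real set \<Rightarrow> bool" where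
  "indep_set T \<equiv> indep (\<lambda>x. x) T"

lemma indep_ev_eq_0_iff: "indep v I \<Longrightarrow> vars p \<subseteq> I \<Longrightarrow> ev v p = 0 \<longleftrightarrow> \<not> nontrivial p"
  by (auto simp: indep_def nontrivial_def)

lemma indep_subset: "indep v I \<Longrightarrow> J \<subseteq> I \<Longrightarrow> indep v J"
  by (auto simp: indep_def)

lemma indep_cong:
  assumes "\<And>i. i \<in> I \<Longrightarrow> v i = w i"
  shows "indep v I \<longleftrightarrow> indep w I"
proof -
  have "ev v p = ev w p" if "vars p \<subseteq> I" for p
    by (rule ev_cong) (use assms that in auto)
  then show ?thesis by (auto simp: indep_def)
qed

text \<open>A relation \<open>p\<close> among the new elements pulls back to the relation
  \<open>subst s p\<close> among the old ones. It stays nontrivial, because \<open>p\<close> is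
  nonzero at some positive tuple and every such tuple is a value of \<open>s\<close>. Restricting
  \<open>surj\<close> to positive tuples leaves room for roots and quotients in the
  preimage.\<close>

lemma indep_subst:
  assumes v: "indep v I" and s: "\<And>j. j \<in> J \<Longrightarrow> vars (s j) \<subseteq> I"
    and surj: "\<And>w. (\<And>j. w j > 0) \<Longrightarrow> \<exists>u. \<forall>j\<in>J. ev u (s j) = w j"
  shows "indep (\<lambda>j. ev v (s j)) J"
  unfolding indep_def
proof (intro allI impI)
  fix p :: "'b pexpr" assume p: "vars p \<subseteq> J" "nontrivial p"
  obtain w where w: "\<And>j. w j \<in> {0::real<..}" "ev w p \<noteq> 0"
    using nontrivial_nonzero[OF p(2), of "\<lambda>_. {0<..}"] infinite_Ioi by blast
  obtain u where u: "\<forall>j\<in>J. ev u (s j) = w j"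
    using surj w(1) by (meson greaterThan_iff)
  have "ev u (subst s p) = ev w p"
    unfolding ev_subst by (rule ev_cong) (use u p(1) in auto)
  then have "nontrivial (subst s p)"
    using w(2) unfolding nontrivial_def by metis
  moreover have "vars (subst s p) \<subseteq> I"
    using s p(1) by (auto simp: vars_subst)
  ultimately show "ev (\<lambda>j. ev v (s j)) p \<noteq> 0"
    using v unfolding indep_def ev_subst by (metis ev_subst)
qed

lemma indep_reindex:
  assumes "indep v I" "inj_on f J" "f ` J \<subseteq> I"
  shows "indep (\<lambda>j. v (f j)) J"
proof -
  have "indep (\<lambda>j. ev v (PVar (f j))) J"
  proof (rule indep_subst[OF assms(1)])
    fix w :: "_ \<Rightarrow> real"
    show "\<exists>u. \<forall>j\<in>J. ev u (PVar (f j)) = w j"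
      by (rule exI[of _ "\<lambda>i. w (inv_into J f i)"]) (simp add: assms(2))
  qed (use assms(3) in auto)
  then show ?thesis by simp
qed

lemma indep_set_image:
  assumes "indep v I"
  shows "indep_set (v ` I)"
proof -
  have "indep (\<lambda>x. v (inv_into I v x)) (v ` I)"
    by (rule indep_reindex[OF assms]) (auto simp: inj_on_inv_into inv_into_into)
  then show ?thesis
    by (subst (asm) indep_cong[where w = "\<lambda>x. x"]) (auto simp: f_inv_into_f)
qed

lemma indep_nonzero:
  assumes "indep v I" "i \<in> I"
  shows "v i \<noteq> 0"
proof -
  have "ev (\<lambda>_. 1) (PVar i) \<noteq> 0" by simp
  then have "nontrivial (PVar i)" unfolding nontrivial_def by blast
  then show ?thesis using indep_ev_eq_0_iff[OF assms(1), of "PVar i"] assms(2) by simp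
qed

lemma indep_finite_char:
  assumes "\<And>J. finite J \<Longrightarrow> J \<subseteq> I \<Longrightarrow> indep v J"
  shows "indep v I"
  using assms finite_vars unfolding indep_def by blast

text \<open>The subfield of the reals generated by \<open>T\<close>. The elements of
  \<open>T\<close> serve as their own variables, evaluated at the identity.\<close>

definition gen :: "real set \<Rightarrow> real set" where
  "gen T = {ev (\<lambda>x. x) p / ev (\<lambda>x. x) q | p q.
              vars p \<subseteq> T \<and> vars q \<subseteq> T \<and> ev (\<lambda>x. x) q \<noteq> 0}"

lemma genI:
  "x = ev (\<lambda>x. x) p / ev (\<lambda>x. x) q \<Longrightarrow> vars p \<subseteq> T \<Longrightarrow> vars q \<subseteq> T \<Longrightarrow> ev (\<lambda>x. x) q \<noteq> 0 \<Longrightarrow> x \<in> gen T"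
  unfolding gen_def by blast

lemma genE:
  assumes "x \<in> gen T"
  obtains p q where "x = ev (\<lambda>x. x) p / ev (\<lambda>x. x) q" "vars p \<subseteq> T" "vars q \<subseteq> T" "ev (\<lambda>x. x) q \<noteq> 0"
  using assms unfolding gen_def by blast

lemma gen_ev: "vars p \<subseteq> T \<Longrightarrow> ev (\<lambda>x. x) p \<in> gen T"
  by (rule genI[of _ p "PConst 1"]) auto

lemma gen_superset: "T \<subseteq> gen T"
  using gen_ev[of "PVar _" T] by auto

lemma real_subfield_gen: "real_subfield (gen T)"
  unfolding real_subfield_def
proof (intro conjI ballI)
  show "1 \<in> gen T" using gen_ev[of "PConst 1" T] by simp
  fix x assume "x \<in> gen T"
  then obtain p q where p: "x = ev (\<lambda>x. x) p / ev (\<lambda>x. x) q" "vars p \<subseteq> T" "vars q \<subseteq> T" "ev (\<lambda>x. x) q \<noteq> 0"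
    by (rule genE)
  show "inverse x \<in> gen T"
  proof (cases "x = 0")
    case True
    then show ?thesis using gen_ev[of "PConst 0" T] by simp
  next
    case False
    then show ?thesis
      using p by (intro genI[of _ q p]) auto
  qed
  fix y assume "y \<in> gen T"
  then obtain p' q' where q: "y = ev (\<lambda>x. x) p' / ev (\<lambda>x. x) q'" "vars p' \<subseteq> T" "vars q' \<subseteq> T" "ev (\<lambda>x. x) q' \<noteq> 0"
    by (rule genE)
  show "x - y \<in> gen T"
    using p q by (intro genI[of _ "PSub (PMul p q') (PMul p' q)" "PMul q q'"]) (auto simp: diff_frac_eq mult.commute)
  show "x * y \<in> gen T"
    using p q by (intro genI[of _ "PMul p p'" "PMul q q'"]) auto
qed

text \<open>All variables but \<open>x\<close> are specialised to themselves. Some coefficient is a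
  nontrivial expression in \<open>T\<close>, and independence keeps it nonzero after the
  specialisation.\<close>

lemma expand_at_indep:
  assumes T: "indep_set T" and p: "vars p \<subseteq> insert x T" "nontrivial p"
  obtains P where "P \<noteq> 0" "\<And>k. poly.coeff P k \<in> gen T" "\<And>y. ev ((\<lambda>x. x)(x := y)) p = poly P y"
proof -
  obtain c where c: "expands c x p" using expand_variable[of x p] ..
  obtain P where P: "\<And>v k. poly.coeff (P v) k = ev v (c k)" "\<And>v y. ev (v(x := y)) p = poly (P v) y"
    using c by (rule expandsE) (rule that)
  obtain v where v: "ev v p \<noteq> 0" using p(2) by (auto simp: nontrivial_def)
  have "poly (P v) (v x) \<noteq> 0" using v P(2)[of v "v x"] by simp
  then have "P v \<noteq> 0" by auto
  then obtain k where "poly.coeff (P v) k \<noteq> 0" by (metis leading_coeff_0_iff)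
  then have "nontrivial (c k)" using P(1) by (auto simp: nontrivial_def)
  moreover have vars: "vars (c k) \<subseteq> T" for k
    using c p(1) by (auto simp: expands_def)
  ultimately have "ev (\<lambda>x. x) (c k) \<noteq> 0" using T by (auto simp: indep_def)
  then have "P (\<lambda>x. x) \<noteq> 0" using P(1) by (metis coeff_0)
  moreover have "poly.coeff (P (\<lambda>x. x)) k \<in> gen T" for k
    using vars by (simp add: P(1) gen_ev)
  ultimately show thesis using that P(2) by blast
qed

lemma indep_insert:
  assumes T: "indep_set T" and x: "\<not> algebraic_over (gen T) x"
  shows "indep_set (insert x T)"
  unfolding indep_def
proof (intro allI impI notI)
  fix p assume p: "vars p \<subseteq> insert x T" "nontrivial p" "ev (\<lambda>x. x) p = 0"
  obtain P where P: "P \<noteq> 0" "\<And>k. poly.coeff P k \<in> gen T" "\<And>y. ev ((\<lambda>x. x)(x := y)) p = poly P y"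
    using expand_at_indep[OF T p(1,2)] by blast
  have "poly P x = 0"
    using P(3)[of x] p(3) by (simp add: fun_upd_idem)
  then show False using x P(1,2) unfolding algebraic_over_def by blast
qed

lemma ev_Ints: "(\<And>i. w i \<in> \<int>) \<Longrightarrow> ev w p \<in> \<int>"
  by (induction p) auto

text \<open>The exponent of 2 is divisible by 3 on one side and congruent to 1 modulo 3 on the
  other.\<close>

lemma cube_ne_twice_cube:
  fixes a b :: int
  assumes "b \<noteq> 0"
  shows "a ^ 3 \<noteq> 2 * b ^ 3"
proof
  assume eq: "a ^ 3 = 2 * b ^ 3"
  then have "a \<noteq> 0" using assms by auto
  have p: "prime_elem (2::int)" by simp
  have "3 * multiplicity 2 a = multiplicity 2 (a ^ 3)"
    using prime_elem_multiplicity_power_distrib[OF p \<open>a \<noteq> 0\<close>] by simp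
  also have "\<dots> = multiplicity 2 (2::int) + multiplicity 2 (b ^ 3)"
    unfolding eq using assms by (intro prime_elem_multiplicity_mult_distrib) auto
  also have "\<dots> = 1 + 3 * multiplicity 2 b"
    using prime_elem_multiplicity_power_distrib[OF p assms] by simp
  finally show False by presburger
qed

text \<open>If \<open>r\<close> were a quotient of values of \<open>p\<close> and \<open>q\<close>,
  cubing would give a polynomial identity in which \<open>r ^ 3\<close> is a variable. Integer
  values for the variables, with twice a nonzero cube for \<open>r ^ 3\<close>, would then make 2 a
  rational cube.\<close>

lemma cube_root_notin_gen:
  assumes T: "indep_set T" and u: "r ^ 3 \<in> T"
  shows "r \<notin> gen T"
proof
  assume "r \<in> gen T"
  then obtain p q where pq: "r = ev (\<lambda>x. x) p / ev (\<lambda>x. x) q" "vars p \<subseteq> T" "vars q \<subseteq> T" "ev (\<lambda>x. x) q \<noteq> 0"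
    by (rule genE)
  let ?u = "r ^ 3"
  let ?e = "PSub (PMul p (PMul p p)) (PMul (PVar ?u) (PMul q (PMul q q)))"
  have "ev (\<lambda>x. x) p = r * ev (\<lambda>x. x) q" using pq by simp
  then have "ev (\<lambda>x. x) ?e = 0" by (simp add: power3_eq_cube)
  moreover have "vars ?e \<subseteq> T" using pq u by auto
  ultimately have triv: "\<not> nontrivial ?e" using indep_ev_eq_0_iff[OF T] by blast
  have q: "nontrivial q" using pq(4) by (auto simp: nontrivial_def)
  \<comment> \<open>Every value set is infinite, so \<open>q\<close> can be kept nonzero;
    \<open>Suc n\<close> keeps the value of \<open>r ^ 3\<close> nonzero.\<close>
  define A where "A i = (if i = ?u then (\<lambda>n. of_int (2 * int (Suc n) ^ 3)) ` UNIV else (\<int> :: real set))" for i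
  have "m = n" if "Suc m ^ 3 = Suc n ^ 3" for m n
    using power_eq_iff_eq_base[of 3 "Suc m" "Suc n"] that by simp
  then have "inj (\<lambda>n. real_of_int (2 * int (Suc n) ^ 3))"
    by (intro injI) (simp del: of_nat_Suc flip: of_nat_power)
  then have "infinite (A i)" for i
    unfolding A_def using infinite_UNIV_nat infinite_UNIV_int by (auto simp: Ints_def inj_on_def dest!: finite_imageD)
  with q obtain w where w: "\<And>i. w i \<in> A i" "ev w q \<noteq> 0"
    by (rule nontrivial_nonzero) (rule that)
  have "w i \<in> \<int>" for i using w(1)[of i] by (auto simp: A_def split: if_splits)
  then obtain a b where ab: "ev w p = of_int a" "ev w q = of_int b"
    using ev_Ints by (metis Ints_cases)
  obtain n where n: "w ?u = of_int (2 * int (Suc n) ^ 3)"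
    using w(1)[of ?u] by (auto simp: A_def)
  have "ev w ?e = 0" using triv by (auto simp: nontrivial_def)
  then have "ev w p ^ 3 = w ?u * ev w q ^ 3"
    by (simp add: power3_eq_cube[of "ev w p"] power3_eq_cube[of "ev w q"])
  then have "real_of_int (a ^ 3) = of_int (2 * int (Suc n) ^ 3 * b ^ 3)"
    unfolding ab n by (simp only: of_int_mult of_int_power)
  then have "a ^ 3 = 2 * (int (Suc n) * b) ^ 3"
    unfolding of_int_eq_iff by (simp only: power_mult_distrib mult.assoc)
  moreover have "int (Suc n) * b \<noteq> 0" using w(2) ab by simp
  ultimately show False using cube_ne_twice_cube by blast
qed

text \<open>A fraction is sent to the same pair of expressions evaluated at \<open>g\<close>. Both
  bases are independent, so equality of fractions means the same polynomial identity on either side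
  (\<open>frac\<close>); this gives well-definedness and injectivity at once.\<close>

lemma isomorphic_gen:
  assumes T: "indep_set T" and T': "indep_set T'" and g: "bij_betw g T T'"
  shows "isomorphic_fields (gen T) (gen T')"
proof -
  let ?e = "ev (\<lambda>x. x)"
  have "inj_on g T" "g ` T = T'" using g by (auto simp: bij_betw_def)
  then have gT: "indep g T" using indep_reindex[OF T', of g T] by simp
  have zero: "?e p = 0 \<longleftrightarrow> ev g p = 0" if "vars p \<subseteq> T" for p
    using indep_ev_eq_0_iff[OF T that] indep_ev_eq_0_iff[OF gT that] by simp
  have frac: "?e p / ?e q = ?e p' / ?e q' \<longleftrightarrow> ev g p / ev g q = ev g p' / ev g q'"
    if "vars p \<subseteq> T" "vars q \<subseteq> T" "vars p' \<subseteq> T" "vars q' \<subseteq> T" "?e q \<noteq> 0" "?e q' \<noteq> 0" for p q p' q'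
    using zero[of "PSub (PMul p q') (PMul p' q)"] zero[of q] zero[of q'] that
    by (simp add: field_simps)
  \<comment> \<open>The choice ranges over all representations of \<open>x\<close>; by
    \<open>frac\<close> they lead to the same value.\<close>
  define h where "h x = (SOME y. \<exists>p q. vars p \<subseteq> T \<and> vars q \<subseteq> T \<and> ?e q \<noteq> 0 \<and>
     x = ?e p / ?e q \<and> y = ev g p / ev g q)" for x
  have h: "h (?e p / ?e q) = ev g p / ev g q" if "vars p \<subseteq> T" "vars q \<subseteq> T" "?e q \<noteq> 0" for p q
    unfolding h_def
  proof (rule some_equality)
    fix y assume "\<exists>p' q'. vars p' \<subseteq> T \<and> vars q' \<subseteq> T \<and> ?e q' \<noteq> 0 \<and>
      ?e p / ?e q = ?e p' / ?e q' \<and> y = ev g p' / ev g q'"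
    then obtain p' q' where "vars p' \<subseteq> T" "vars q' \<subseteq> T" "?e q' \<noteq> 0"
      "?e p / ?e q = ?e p' / ?e q'" "y = ev g p' / ev g q'"
      by (elim exE conjE)
    then show "y = ev g p / ev g q"
      using frac[of p q p' q'] that by simp
  qed (use that in \<open>intro exI[of _ p] exI[of _ q], simp\<close>)
  have nz: "ev g q \<noteq> 0" if "vars q \<subseteq> T" "?e q \<noteq> 0" for q using zero that by blast
  show ?thesis
  proof (rule isomorphic_fieldsI[of h])
    show "h 1 = 1" using h[of "PConst 1" "PConst 1"] by simp
    show "bij_betw h (gen T) (gen T')"
      unfolding bij_betw_def
    proof
      show "inj_on h (gen T)"
      proof (rule inj_onI)
        fix x y assume "x \<in> gen T" "y \<in> gen T" "h x = h y"
        obtain p q where x: "x = ?e p / ?e q" "vars p \<subseteq> T" "vars q \<subseteq> T" "?e q \<noteq> 0"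
          using \<open>x \<in> gen T\<close> by (rule genE) (rule that)
        obtain p' q' where y: "y = ?e p' / ?e q'" "vars p' \<subseteq> T" "vars q' \<subseteq> T" "?e q' \<noteq> 0"
          using \<open>y \<in> gen T\<close> by (rule genE) (rule that)
        show "x = y" using \<open>h x = h y\<close> x y frac[of p q p' q'] by (simp add: h)
      qed
      show "h ` gen T = gen T'"
      proof (intro equalityI subsetI)
        fix y assume "y \<in> h ` gen T"
        then obtain x where "x \<in> gen T" "y = h x" by blast
        then obtain p q where "x = ?e p / ?e q" and pq: "vars p \<subseteq> T" "vars q \<subseteq> T" "?e q \<noteq> 0"
          by (auto elim: genE)
        with \<open>y = h x\<close> have "y = ev g p / ev g q" by (simp add: h)
        then show "y \<in> gen T'"
          using nz[OF pq(2,3)] pq(1,2) \<open>g ` T = T'\<close>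
          by (intro genI[of _ "map_pexpr g p" "map_pexpr g q"]) (auto simp: ev_map pexpr.set_map)
      next
        fix y assume "y \<in> gen T'"
        then obtain p q where pq: "y = ?e p / ?e q" "vars p \<subseteq> T'" "vars q \<subseteq> T'" "?e q \<noteq> 0"
          by (rule genE)
        \<comment> \<open>Surjectivity: a fraction over \<open>T'\<close> is renamed back along the
          inverse of \<open>g\<close>.\<close>
        let ?g = "inv_into T g"
        have ev: "ev g (map_pexpr ?g p) = ?e p" if "vars p \<subseteq> T'" for p
          unfolding ev_map by (rule ev_cong) (use that \<open>g ` T = T'\<close> in \<open>auto simp: f_inv_into_f\<close>)
        have vars: "vars (map_pexpr ?g p) \<subseteq> T" if "vars p \<subseteq> T'" for p
          using that \<open>g ` T = T'\<close> by (auto simp: pexpr.set_map intro!: inv_into_into)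
        have "?e (map_pexpr ?g q) \<noteq> 0" using zero[OF vars] ev pq by simp
        then have "h (?e (map_pexpr ?g p) / ?e (map_pexpr ?g q)) = y"
          using h[OF vars vars] pq ev by simp
        moreover have "?e (map_pexpr ?g p) / ?e (map_pexpr ?g q) \<in> gen T"
          using \<open>?e (map_pexpr ?g q) \<noteq> 0\<close> vars pq by (intro genI) auto
        ultimately show "y \<in> h ` gen T" by blast
      qed
    qed
    fix x y assume "x \<in> gen T" "y \<in> gen T"
    obtain p q where x: "x = ?e p / ?e q" "vars p \<subseteq> T" "vars q \<subseteq> T" "?e q \<noteq> 0"
      using \<open>x \<in> gen T\<close> by (rule genE) (rule that)
    obtain p' q' where y: "y = ?e p' / ?e q'" "vars p' \<subseteq> T" "vars q' \<subseteq> T" "?e q' \<noteq> 0"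
      using \<open>y \<in> gen T\<close> by (rule genE) (rule that)
    have hx: "h x = ev g p / ev g q" and hy: "h y = ev g p' / ev g q'"
      unfolding x(1) y(1) by (rule h; use x y in simp)+
    have nzq: "ev g q \<noteq> 0" "ev g q' \<noteq> 0" using x y nz by blast+
    have "x + y = ?e (PAdd (PMul p q') (PMul p' q)) / ?e (PMul q q')"
      using x y by (simp add: add_frac_eq)
    moreover have "h (?e (PAdd (PMul p q') (PMul p' q)) / ?e (PMul q q')) =
        ev g (PAdd (PMul p q') (PMul p' q)) / ev g (PMul q q')"
      by (rule h) (use x y in auto)
    ultimately have "h (x + y) = ev g (PAdd (PMul p q') (PMul p' q)) / ev g (PMul q q')"
      by (simp only:)
    then show "h (x + y) = h x + h y"
      using nzq by (simp add: hx hy add_frac_eq)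
    have "x * y = ?e (PMul p p') / ?e (PMul q q')"
      using x y by simp
    moreover have "h (?e (PMul p p') / ?e (PMul q q')) = ev g (PMul p p') / ev g (PMul q q')"
      by (rule h) (use x y in auto)
    ultimately have "h (x * y) = ev g (PMul p p') / ev g (PMul q q')"
      by (simp only:)
    then show "h (x * y) = h x * h y"
      by (simp add: hx hy)
  qed
qed

text \<open>Zorn's lemma yields a transcendence basis above \<open>U\<close>: an element not
  algebraic over \<open>gen T\<close> could still be added by \<open>indep_insert\<close>.\<close>

lemma maximal_indep:
  assumes U: "indep_set U"
  obtains T where "U \<subseteq> T" "indep_set T" "\<And>x. algebraic_over (gen T) x"
proof -
  define \<A> where "\<A> = {T. U \<subseteq> T \<and> indep_set T}"
  have "\<exists>Y\<in>\<A>. \<forall>Z\<in>\<A>. Y \<subseteq> Z \<longrightarrow> Z = Y"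
  proof (rule subset_Zorn_nonempty)
    show "\<A> \<noteq> {}" using U by (auto simp: \<A>_def)
    fix C assume C: "C \<noteq> {}" "subset.chain \<A> C"
    have "indep_set (\<Union>C)"
    proof (rule indep_finite_char)
      fix J assume "finite J" "J \<subseteq> \<Union>C"
      then obtain Z where "Z \<in> C" "J \<subseteq> Z"
        using finite_subset_Union_chain[OF _ _ C(1) C(2)] by blast
      then show "indep_set J"
        using C(2) indep_subset[of _ Z J] by (auto simp: subset_chain_def \<A>_def)
    qed
    moreover have "U \<subseteq> Z" if "Z \<in> C" for Z
      using C(2) that by (auto simp: subset_chain_def \<A>_def)
    ultimately show "\<Union>C \<in> \<A>"
      using C(1) by (auto simp: \<A>_def)
  qed
  then obtain T where "T \<in> \<A>" and max: "\<forall>Z\<in>\<A>. T \<subseteq> Z \<longrightarrow> Z = T"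
    by (elim bexE)
  then have T: "U \<subseteq> T" "indep_set T" by (simp_all add: \<A>_def)
  have "algebraic_over (gen T) x" for x
  proof (cases "x \<in> T")
    case True
    then have "x \<in> gen T" using gen_superset by auto
    then have "poly.coeff [:- x, 1:] k \<in> gen T" for k
      using real_subfield_intros[OF real_subfield_gen[of T]]
      by (simp add: coeff_pCons split: nat.splits)
    then show ?thesis
      unfolding algebraic_over_def by (intro exI[of _ "[:- x, 1:]"]) auto
  next
    case False
    have "insert x T \<notin> \<A>" using max False by blast
    then show ?thesis
      using indep_insert[OF T(2), of x] T(1) by (auto simp: \<A>_def)
  qed
  then show thesis by (rule that[OF T])
qed



section \<open>Fields maximal without a given cube root\<close>

definition maximal_avoiding :: "real \<Rightarrow> real set \<Rightarrow> bool" where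
  "maximal_avoiding r K \<longleftrightarrow> real_subfield K \<and> r \<notin> K \<and>
     (\<forall>L. real_subfield L \<longrightarrow> K \<subseteq> L \<longrightarrow> r \<notin> L \<longrightarrow> L = K)"

text \<open>Zorn's lemma; the union of a chain is a field because any two of its elements lie in a
  common member.\<close>

lemma maximal_avoiding_exists:
  assumes "real_subfield F" "r \<notin> F"
  obtains K where "F \<subseteq> K" "maximal_avoiding r K"
proof -
  define \<A> where "\<A> = {L. F \<subseteq> L \<and> real_subfield L \<and> r \<notin> L}"
  have "\<exists>Y\<in>\<A>. \<forall>Z\<in>\<A>. Y \<subseteq> Z \<longrightarrow> Z = Y"
  proof (rule subset_Zorn_nonempty)
    show "\<A> \<noteq> {}" using assms by (auto simp: \<A>_def)
    fix C assume C: "C \<noteq> {}" "subset.chain \<A> C"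
    then have sub: "F \<subseteq> Z" "real_subfield Z" "r \<notin> Z" if "Z \<in> C" for Z
      using that by (auto simp: subset_chain_def \<A>_def)
    have common: "\<exists>Z\<in>C. x \<in> Z \<and> y \<in> Z" if "x \<in> \<Union>C" "y \<in> \<Union>C" for x y
    proof -
      obtain Z Z' where "Z \<in> C" "x \<in> Z" "Z' \<in> C" "y \<in> Z'" using \<open>x \<in> \<Union>C\<close> \<open>y \<in> \<Union>C\<close> by blast
      moreover have "Z \<subseteq> Z' \<or> Z' \<subseteq> Z"
        using C(2) \<open>Z \<in> C\<close> \<open>Z' \<in> C\<close> by (simp add: subset_chain_def)
      ultimately show ?thesis by blast
    qed
    have "real_subfield (\<Union>C)"
      unfolding real_subfield_def
    proof (intro conjI ballI)
      obtain Z where "Z \<in> C" using C(1) by blast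
      then show "1 \<in> \<Union>C" using real_subfield_1[OF sub(2)] by blast
      fix x assume x: "x \<in> \<Union>C"
      then obtain Z where "Z \<in> C" "x \<in> Z" by blast
      then show "inverse x \<in> \<Union>C" using real_subfield_inverse[OF sub(2)] by blast
      fix y assume y: "y \<in> \<Union>C"
      obtain Z where "Z \<in> C" "x \<in> Z" "y \<in> Z" using common[OF x y] by blast
      then show "x - y \<in> \<Union>C" "x * y \<in> \<Union>C"
        using real_subfield_diff[OF sub(2)] real_subfield_mult[OF sub(2)] by blast+
    qed
    then show "\<Union>C \<in> \<A>"
      using C(1) sub(1,3) by (auto simp: \<A>_def)
  qed
  then obtain K where "K \<in> \<A>" and max: "\<forall>Z\<in>\<A>. K \<subseteq> Z \<longrightarrow> Z = K"
    by (elim bexE)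
  then have K: "F \<subseteq> K" "real_subfield K" "r \<notin> K" by (simp_all add: \<A>_def)
  have "L = K" if "real_subfield L" "K \<subseteq> L" "r \<notin> L" for L
    using max that K(1) by (auto simp: \<A>_def)
  then have "maximal_avoiding r K"
    using K(2,3) by (simp add: maximal_avoiding_def)
  then show thesis by (rule that[OF K(1)])
qed

text \<open>Inverses come from rationalising the denominator; the conjugate
  \<open>u - v * sqrt d\<close> of a nonzero element cannot vanish, since \<open>sqrt d\<close> lies
  outside \<open>K\<close>.\<close>

lemma quadratic_extension:
  assumes K: "real_subfield K" and d: "d \<in> K" "d > 0" "sqrt d \<notin> K"
  shows "real_subfield {u + v * sqrt d |u v. u \<in> K \<and> v \<in> K}" (is "real_subfield ?L")
  unfolding real_subfield_def
proof (intro conjI ballI)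
  note intros = real_subfield_intros[OF K]
  have mem: "u + v * sqrt d \<in> ?L" if "u \<in> K" "v \<in> K" for u v
    using that by blast
  show "1 \<in> ?L" using mem[OF intros(2,1)] by simp
  fix x assume "x \<in> ?L"
  then obtain u v where x: "x = u + v * sqrt d" "u \<in> K" "v \<in> K" by blast
  have ss: "sqrt d * (sqrt d * a) = d * a" for a using d(2) by (simp flip: mult.assoc)
  show "inverse x \<in> ?L"
  proof (cases "x = 0")
    case True
    then show ?thesis using \<open>x \<in> ?L\<close> by (simp only: inverse_zero)
  next
    case False
    let ?n = "u ^ 2 - v ^ 2 * d"
    have n: "?n = x * (u - v * sqrt d)"
      using d(2) by (simp add: x power2_eq_square algebra_simps ss)
    have n0: "u - v * sqrt d \<noteq> 0"
    proof
      assume 0: "u - v * sqrt d = 0"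
      have "v = 0"
      proof (rule ccontr)
        assume "v \<noteq> 0"
        then have "sqrt d = u / v" using 0 by (simp add: eq_divide_eq mult.commute)
        then show False using d(3) intros(8)[OF x(2,3)] by metis
      qed
      then show False using 0 False x(1) by simp
    qed
    have "u / ?n + (- v / ?n) * sqrt d = (u - v * sqrt d) / ?n"
      by (simp add: diff_divide_distrib)
    also have "\<dots> = inverse x" using False n0 unfolding n by (simp add: field_simps)
    finally have "inverse x = u / ?n + (- v / ?n) * sqrt d" ..
    also have "\<dots> \<in> ?L" by (intro mem intros x d)
    finally show ?thesis .
  qed
  fix y assume "y \<in> ?L"
  then obtain u' v' where y: "y = u' + v' * sqrt d" "u' \<in> K" "v' \<in> K" by blast
  have "x - y = (u - u') + (v - v') * sqrt d" by (simp add: x y algebra_simps)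
  also have "\<dots> \<in> ?L" by (intro mem intros x y)
  finally show "x - y \<in> ?L" .
  have "x * y = (u * u' + v * v' * d) + (u * v' + v * u') * sqrt d"
    using d(2) by (simp add: x y algebra_simps ss)
  also have "\<dots> \<in> ?L" by (intro mem intros x y d)
  finally show "x * y \<in> ?L" .
qed

text \<open>A cube root cannot be created by a real quadratic extension: if \<open>u + v \<surd>d\<close> has its cube in \<open>K\<close>,
  the \<open>\<surd>d\<close>-part \<open>v (3 u\<^sup>2 + v\<^sup>2 d)\<close> of the cube vanishes, which forces \<open>v = 0\<close>.\<close>

lemma maximal_avoiding_sqrt:
  assumes max: "maximal_avoiding r K" and r: "r ^ 3 \<in> K" and d: "d \<in> K" "d > 0"
  shows "sqrt d \<in> K"
proof (rule ccontr)
  assume nd: "sqrt d \<notin> K"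
  have K: "real_subfield K" and rK: "r \<notin> K" using max by (auto simp: maximal_avoiding_def)
  note intros = real_subfield_intros[OF K]
  let ?L = "{u + v * sqrt d |u v. u \<in> K \<and> v \<in> K}"
  have mem: "u + v * sqrt d \<in> ?L" if "u \<in> K" "v \<in> K" for u v
    using that by blast
  have "K \<subseteq> ?L" using mem[OF _ intros(1)] by auto
  moreover have "sqrt d \<in> ?L" using mem[OF intros(1,2)] by simp
  \<comment> \<open>\<open>?L\<close> is strictly larger than \<open>K\<close>, so maximality forces
    \<open>r\<close> into it.\<close>
  ultimately have "r \<in> ?L"
    using max quadratic_extension[OF K d nd] nd unfolding maximal_avoiding_def by blast
  then obtain u v where uv: "r = u + v * sqrt d" "u \<in> K" "v \<in> K" by blast
  have v: "v \<noteq> 0" using uv rK by auto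
  have "(u + v * s) ^ 3 = (u ^ 3 + 3 * u * v ^ 2 * s ^ 2) + v * (3 * u ^ 2 + v ^ 2 * s ^ 2) * s" for s
    by (simp add: power2_eq_square power3_eq_cube algebra_simps)
  from this[of "sqrt d"]
  have eq: "r ^ 3 = (u ^ 3 + 3 * u * v ^ 2 * d) + v * (3 * u ^ 2 + v ^ 2 * d) * sqrt d"
    using d(2) uv(1) by simp
  have "v ^ 2 * d > 0" using v d(2) by simp
  then have "3 * u ^ 2 + v ^ 2 * d > 0" by (simp add: add_nonneg_pos)
  then have "v * (3 * u ^ 2 + v ^ 2 * d) \<noteq> 0" using v by simp
  then have "sqrt d = (r ^ 3 - (u ^ 3 + 3 * u * v ^ 2 * d)) / (v * (3 * u ^ 2 + v ^ 2 * d))"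
    unfolding eq by simp
  also have "\<dots> \<in> K"
  proof -
    have "3 \<in> K" using intros(10)[of 3] by simp
    \<comment> \<open>Here \<open>c\<close> stands for \<open>r ^ 3\<close>: with the power written
      out, the closure rule for powers would ask for \<open>r \<in> K\<close>.\<close>
    then have "(c - (u ^ 3 + 3 * u * v ^ 2 * d)) / (v * (3 * u ^ 2 + v ^ 2 * d)) \<in> K" if "c \<in> K" for c
      by (intro intros uv(2,3) d(1) that \<open>3 \<in> K\<close>)
    then show ?thesis using r by blast
  qed
  finally show False using nd by simp
qed

section \<open>Simple extensions and polynomials with coefficients in a subfield\<close>

definition coeffs_in :: "real set \<Rightarrow> real poly \<Rightarrow> bool" where
  "coeffs_in K P \<longleftrightarrow> (\<forall>k. poly.coeff P k \<in> K)"

lemma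
  assumes K: "real_subfield K"
  shows coeffs_in_const: "a \<in> K \<Longrightarrow> coeffs_in K [:a:]"
    and coeffs_in_X: "coeffs_in K [:0, 1:]"
    and coeffs_in_diff: "coeffs_in K P \<Longrightarrow> coeffs_in K Q \<Longrightarrow> coeffs_in K (P - Q)"
    and coeffs_in_mult: "coeffs_in K P \<Longrightarrow> coeffs_in K Q \<Longrightarrow> coeffs_in K (P * Q)"
proof -
  show "a \<in> K \<Longrightarrow> coeffs_in K [:a:]"
    using real_subfield_0[OF K] by (simp add: coeffs_in_def coeff_pCons split: nat.splits)
  show "coeffs_in K [:0, 1:]"
    using real_subfield_0[OF K] real_subfield_1[OF K]
    by (simp add: coeffs_in_def coeff_pCons split: nat.splits)
  show "coeffs_in K P \<Longrightarrow> coeffs_in K Q \<Longrightarrow> coeffs_in K (P - Q)"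
    by (simp add: coeffs_in_def real_subfield_diff[OF K])
  show "coeffs_in K P \<Longrightarrow> coeffs_in K Q \<Longrightarrow> coeffs_in K (P * Q)"
    by (simp add: coeffs_in_def coeff_mult real_subfield_sum[OF K] real_subfield_mult[OF K])
qed

lemma simple_extension_field:
  assumes K: "real_subfield K"
  shows "real_subfield {poly P y / poly Q y |P Q. coeffs_in K P \<and> coeffs_in K Q \<and> poly Q y \<noteq> 0}"
    (is "real_subfield ?L")
  unfolding real_subfield_def
proof (intro conjI ballI)
  note intros = real_subfield_intros[OF K]
  note cs = coeffs_in_const[OF K] coeffs_in_diff[OF K] coeffs_in_mult[OF K]
  have mem: "poly P y / poly Q y \<in> ?L" if "coeffs_in K P" "coeffs_in K Q" "poly Q y \<noteq> 0" for P Q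
    using that by blast
  have "poly [:1:] y / poly [:1:] y \<in> ?L"
    by (rule mem) (simp_all add: cs(1)[OF intros(2)])
  moreover have "poly [:1:] y / poly [:1:] y = 1" by simp
  ultimately show "1 \<in> ?L" by (simp only:)
  fix x assume "x \<in> ?L"
  then obtain P Q where x: "x = poly P y / poly Q y" "coeffs_in K P" "coeffs_in K Q" "poly Q y \<noteq> 0"
    by blast
  show "inverse x \<in> ?L"
  proof (cases "x = 0")
    case True
    then show ?thesis using \<open>x \<in> ?L\<close> by (simp only: inverse_zero)
  next
    case False
    then have "inverse x = poly Q y / poly P y" and nz: "poly P y \<noteq> 0" using x(1) by simp_all
    then show ?thesis using mem[OF x(3,2) nz] by (simp only:)
  qed
  fix z assume "z \<in> ?L"
  then obtain P' Q' where z: "z = poly P' y / poly Q' y" "coeffs_in K P'" "coeffs_in K Q'" "poly Q' y \<noteq> 0"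
    by blast
  have "x - z = poly (P * Q' - P' * Q) y / poly (Q * Q') y"
    using x(1,4) z(1,4) by (simp add: diff_frac_eq)
  also have "\<dots> \<in> ?L"
    by (rule mem) (simp_all add: x z cs)
  finally show "x - z \<in> ?L" .
  have "x * z = poly (P * P') y / poly (Q * Q') y"
    using x(1) z(1) by simp
  also have "\<dots> \<in> ?L"
    by (rule mem) (simp_all add: x z cs)
  finally show "x * z \<in> ?L" .
qed

text \<open>For \<open>y\<close> transcendental over \<open>K\<close>, an equation \<open>r = P(y) / Q(y)\<close> with \<open>r\<^sup>3 \<in> K\<close> gives
  \<open>P\<^sup>3 = r\<^sup>3 Q\<^sup>3\<close> as polynomials, and \<open>r\<close> is the quotient of the leading coefficients.\<close>

lemma maximal_avoiding_algebraic:
  assumes max: "maximal_avoiding r K" and r: "r ^ 3 \<in> K"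
  shows "algebraic_over K y"
proof (rule ccontr)
  assume na: "\<not> algebraic_over K y"
  have K: "real_subfield K" and rK: "r \<notin> K" using max by (auto simp: maximal_avoiding_def)
  note intros = real_subfield_intros[OF K]
  note cs = coeffs_in_const[OF K] coeffs_in_diff[OF K] coeffs_in_mult[OF K] coeffs_in_X[OF K]
  have y: "y \<notin> K"
  proof
    assume "y \<in> K"
    have "coeffs_in K ([:0, 1:] - [:y:])" using \<open>y \<in> K\<close> by (intro cs)
    moreover have "[:0, 1:] - [:y:] \<noteq> 0" "poly ([:0, 1:] - [:y:]) y = 0" by simp_all
    ultimately show False using na unfolding algebraic_over_def coeffs_in_def by blast
  qed
  let ?L = "{poly P y / poly Q y |P Q. coeffs_in K P \<and> coeffs_in K Q \<and> poly Q y \<noteq> 0}"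
  have mem: "poly P y / poly Q y \<in> ?L" if "coeffs_in K P" "coeffs_in K Q" "poly Q y \<noteq> 0" for P Q
    using that by blast
  have one: "coeffs_in K [:1:]" using cs(1) intros(2) by blast
  have "K \<subseteq> ?L"
  proof
    fix a assume "a \<in> K"
    have "poly [:a:] y / poly [:1:] y \<in> ?L" by (rule mem) (simp_all add: cs one \<open>a \<in> K\<close>)
    moreover have "poly [:a:] y / poly [:1:] y = a" by simp
    ultimately show "a \<in> ?L" by (simp only:)
  qed
  moreover have "y \<in> ?L"
  proof -
    have "poly [:0, 1:] y / poly [:1:] y \<in> ?L" by (rule mem) (simp_all add: cs one)
    moreover have "poly [:0, 1:] y / poly [:1:] y = y" by simp
    ultimately show ?thesis by (simp only:)
  qed
  \<comment> \<open>\<open>?L\<close> is the field generated by \<open>y\<close> over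
    \<open>K\<close>; it contains \<open>y\<close> while \<open>K\<close> does not, so by maximality
    it contains \<open>r\<close>.\<close>
  ultimately have "r \<in> ?L"
    using max simple_extension_field[OF K, of y] y unfolding maximal_avoiding_def by blast
  then obtain P Q where PQ: "r = poly P y / poly Q y" "coeffs_in K P" "coeffs_in K Q" "poly Q y \<noteq> 0"
    by blast
  let ?R = "P * (P * P) - [:r ^ 3:] * (Q * (Q * Q))"
  have "poly P y = r * poly Q y" using PQ by simp
  then have "poly ?R y = 0" by (simp add: power3_eq_cube)
  moreover have "coeffs_in K ?R" using PQ r by (intro cs)
  ultimately have "?R = 0" using na unfolding algebraic_over_def coeffs_in_def by blast
  then have "Polynomial.lead_coeff (P * (P * P)) = Polynomial.lead_coeff ([:r ^ 3:] * (Q * (Q * Q)))" by simp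
  then have "Polynomial.lead_coeff P ^ 3 = (r * Polynomial.lead_coeff Q) ^ 3"
    unfolding lead_coeff_mult by (simp add: power3_eq_cube[of "Polynomial.lead_coeff P"]
        power3_eq_cube[of "Polynomial.lead_coeff Q"] power_mult_distrib)
  \<comment> \<open>Real cube roots are unique.\<close>
  then have "Polynomial.lead_coeff P = r * Polynomial.lead_coeff Q"
    by (metis odd_real_root_power_cancel odd_numeral)
  moreover have "Polynomial.lead_coeff Q \<noteq> 0" using PQ(4) by auto
  ultimately have "r = Polynomial.lead_coeff P / Polynomial.lead_coeff Q" by simp
  then have "r \<in> K" using PQ(2,3) intros(8) unfolding coeffs_in_def by blast
  then show False using rK by simp
qed

text \<open>The twists \<open>S\<close> decide for each \<open>t \<in> Y\<close> whether \<open>t\<close> or \<open>t r\<close> is adjoined; a field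
  containing both contains \<open>r\<close>.\<close>

definition twist :: "real set \<Rightarrow> real set \<Rightarrow> real \<Rightarrow> real set \<Rightarrow> real set" where
  "twist A Y r S = insert (r ^ 3) (A \<union> (Y - S) \<union> (\<lambda>t. t * r) ` S)"

text \<open>The twist arises by substituting \<open>r ^ 3\<close> for \<open>r\<close> and
  \<open>t * r\<close> for each \<open>t \<in> S\<close>. Given positive targets, a cube root
  determines the value of \<open>r\<close>, and division by it the values of the
  \<open>t\<close>.\<close>

lemma indep_twist:
  assumes ind: "indep_set (insert r (A \<union> Y))" and disj: "A \<inter> Y = {}" "r \<notin> A \<union> Y" and S: "S \<subseteq> Y"
  shows "indep_set (twist A Y r S)"
proof -
  let ?J = "insert r (A \<union> Y)"
  let ?s = "\<lambda>t. if t = r then PMul (PVar r) (PMul (PVar r) (PVar r))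
             else if t \<in> S then PMul (PVar t) (PVar r) else PVar t"
  have "indep (\<lambda>t. ev (\<lambda>x. x) (?s t)) ?J"
  proof (rule indep_subst[OF ind])
    fix w :: "real \<Rightarrow> real" assume w: "\<And>j. w j > 0"
    let ?c = "root 3 (w r)"
    have c: "?c * (?c * ?c) = w r" "?c > 0"
      using w[of r] real_root_pow_pos[of 3 "w r"] by (simp_all add: power3_eq_cube mult.assoc)
    let ?u = "\<lambda>t. if t = r then ?c else if t \<in> S then w t / ?c else w t"
    have "ev ?u (?s j) = w j" for j
      using c by (cases "j = r"; cases "j \<in> S") simp_all
    then show "\<exists>u. \<forall>j\<in>?J. ev u (?s j) = w j" by blast
  qed (use S in auto)
  then have "indep_set ((\<lambda>t. ev (\<lambda>x. x) (?s t)) ` ?J)"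
    by (rule indep_set_image)
  also have "(\<lambda>t. ev (\<lambda>x. x) (?s t)) ` ?J = twist A Y r S"
  proof -
    have "r \<notin> S" "A \<inter> S = {}" "A \<union> Y = A \<union> (Y - S) \<union> S" "r \<notin> A" "r \<notin> Y" using disj S by auto
    then have "(\<lambda>t. ev (\<lambda>x. x) (?s t)) ` (A \<union> (Y - S)) = A \<union> (Y - S)"
      "(\<lambda>t. ev (\<lambda>x. x) (?s t)) ` S = (\<lambda>t. t * r) ` S"
      by (force intro!: image_cong[THEN trans[OF _ image_ident]] image_cong)+
    moreover have "ev (\<lambda>x. x) (?s r) = r ^ 3" by (simp add: power3_eq_cube)
    ultimately show ?thesis
      unfolding twist_def by (subst \<open>A \<union> Y = A \<union> (Y - S) \<union> S\<close>) (simp only: image_insert image_Un)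
  qed
  finally show ?thesis .
qed

lemma twist_separated:
  assumes K: "real_subfield K" "r \<notin> K" and "twist A Y r S \<subseteq> K" "twist A Y r S' \<subseteq> K"
    and S: "S \<subseteq> Y" "S' \<subseteq> Y" and nz: "0 \<notin> Y"
  shows "S = S'"
proof -
  have "False" if t: "t \<in> S1" "t \<notin> S2" "S1 \<subseteq> Y" "twist A Y r S1 \<subseteq> K" "twist A Y r S2 \<subseteq> K" for t S1 S2
  proof -
    have "t * r \<in> K" "t \<in> K" using t by (auto simp: twist_def)
    then have "t * r / t \<in> K" using real_subfield_divide[OF K(1)] by blast
    moreover have "t \<noteq> 0" using t nz by blast
    ultimately show False using K(2) by simp
  qed
  then show ?thesis using assms by blast
qed

lemma inj_on_Pow_eqpoll:
  assumes "inj_on F (Pow Y)" "eqpoll Y (UNIV :: real set)"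
  shows "eqpoll (F ` Pow Y) (Pow (UNIV :: real set))"
proof -
  have "eqpoll (F ` Pow Y) (Pow Y)" by (rule inj_on_image_eqpoll_self[OF assms(1)])
  also have "eqpoll (Pow Y) (Pow (UNIV :: real set))"
    using assms(2) unfolding eqpoll_def using bij_betw_Pow by blast
  finally show ?thesis .
qed

text \<open>Each \<open>S \<subseteq> Y\<close> contributes one field to either family: the field
  generated by a transcendence basis above the twist, and a field above the twist that is maximal
  avoiding \<open>r\<close>. By \<open>twist_separated\<close> the field determines
  \<open>S\<close>, so both families have the size of the power set of the reals.\<close>

lemma twisted_families:
  assumes ind: "indep_set (insert r (A \<union> Y))" and disj: "A \<inter> Y = {}" "r \<notin> A \<union> Y"
    and A: "lepoll (UNIV :: real set) A" and Y: "eqpoll Y (UNIV :: real set)"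
  obtains \<F> \<G> where
    "eqpoll \<F> (Pow (UNIV :: real set))" "eqpoll \<G> (Pow (UNIV :: real set))"
    "\<And>K. K \<in> \<F> \<Longrightarrow> A \<subseteq> K \<and> r \<notin> K \<and> (\<exists>T. K = gen T \<and> indep_set T \<and> eqpoll T (UNIV :: real set)
       \<and> (\<forall>x. algebraic_over K x))"
    "\<And>K. K \<in> \<G> \<Longrightarrow> A \<subseteq> K \<and> r ^ 3 \<in> K \<and> maximal_avoiding r K"
proof -
  have nz: "0 \<notin> Y" using indep_nonzero[OF ind] by blast
  let ?U = "twist A Y r"
  \<comment> \<open>Every twist contains \<open>r ^ 3\<close>.\<close>
  have rU: "r \<notin> gen T" if "?U S \<subseteq> T" "indep_set T" for S T
    by (rule cube_root_notin_gen[OF that(2)]) (use that(1) in \<open>auto simp: twist_def\<close>)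
  have indU: "indep_set (?U S)" if "S \<subseteq> Y" for S by (rule indep_twist[OF ind disj that])
  have "\<exists>T. ?U S \<subseteq> T \<and> indep_set T \<and> (\<forall>x. algebraic_over (gen T) x)" if "S \<in> Pow Y" for S
    using maximal_indep[OF indU] that by (metis PowD)
  then obtain T where T: "\<And>S. S \<in> Pow Y \<Longrightarrow> ?U S \<subseteq> T S \<and> indep_set (T S) \<and> (\<forall>x. algebraic_over (gen (T S)) x)"
    by metis
  have "\<exists>K. ?U S \<subseteq> K \<and> maximal_avoiding r K" if "S \<in> Pow Y" for S
    using maximal_avoiding_exists[OF real_subfield_gen rU[OF order_refl indU], of S] gen_superset that
    by (metis PowD order_trans)
  then obtain M where M: "\<And>S. S \<in> Pow Y \<Longrightarrow> ?U S \<subseteq> M S \<and> maximal_avoiding r (M S)"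
    by metis
  \<comment> \<open>\<open>A\<close> alone has the size of the continuum, so all bases are
    equipotent and will generate isomorphic fields.\<close>
  have TY: "eqpoll (T S) (UNIV :: real set)" if "S \<in> Pow Y" for S
  proof (rule lepoll_antisym)
    show "lepoll (T S) (UNIV :: real set)" by (rule subset_imp_lepoll) simp
    have "A \<subseteq> T S" using T[OF that] by (auto simp: twist_def)
    then show "lepoll (UNIV :: real set) (T S)"
      using A lepoll_trans subset_imp_lepoll by blast
  qed
  show thesis
  proof (rule that[of "(\<lambda>S. gen (T S)) ` Pow Y" "M ` Pow Y"])
    have "inj_on (\<lambda>S. gen (T S)) (Pow Y)"
    proof (rule inj_onI)
      fix S S' assume S: "S \<in> Pow Y" "S' \<in> Pow Y" "gen (T S) = gen (T S')"
      have "?U S \<subseteq> gen (T S)" "?U S' \<subseteq> gen (T S)"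
        using T[OF S(1)] T[OF S(2)] gen_superset S(3) by blast+
      moreover have "r \<notin> gen (T S)" using rU[of S "T S"] T[OF S(1)] by blast
      ultimately show "S = S'"
        using twist_separated[OF real_subfield_gen, of r "T S" A Y S S'] S(1,2) nz by blast
    qed
    then show "eqpoll ((\<lambda>S. gen (T S)) ` Pow Y) (Pow (UNIV :: real set))"
      by (rule inj_on_Pow_eqpoll[OF _ Y])
    have "inj_on M (Pow Y)"
    proof (rule inj_onI)
      fix S S' assume S: "S \<in> Pow Y" "S' \<in> Pow Y" "M S = M S'"
      have "real_subfield (M S)" "r \<notin> M S" using M[OF S(1)] by (auto simp: maximal_avoiding_def)
      moreover have "?U S \<subseteq> M S" "?U S' \<subseteq> M S" using M[OF S(1)] M[OF S(2)] S(3) by simp_all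
      ultimately show "S = S'"
        using twist_separated[of "M S" r A Y S S'] S(1,2) nz by blast
    qed
    then show "eqpoll (M ` Pow Y) (Pow (UNIV :: real set))"
      by (rule inj_on_Pow_eqpoll[OF _ Y])
  next
    fix K assume "K \<in> (\<lambda>S. gen (T S)) ` Pow Y"
    then obtain S where S: "S \<in> Pow Y" "K = gen (T S)" by blast
    have "A \<subseteq> ?U S" by (auto simp: twist_def)
    also have "?U S \<subseteq> T S" using T[OF S(1)] by simp
    also have "\<dots> \<subseteq> K" unfolding S(2) by (rule gen_superset)
    finally have "A \<subseteq> K" .
    moreover have "r \<notin> K" unfolding S(2) using rU[of S "T S"] T[OF S(1)] by simp
    ultimately show "A \<subseteq> K \<and> r \<notin> K \<and> (\<exists>T. K = gen T \<and> indep_set T \<and> eqpoll T (UNIV :: real set)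
       \<and> (\<forall>x. algebraic_over K x))"
      using T[OF S(1)] TY[OF S(1)] S(2) by (intro conjI exI[of _ "T S"]) simp_all
  next
    fix K assume "K \<in> M ` Pow Y"
    then obtain S where "S \<in> Pow Y" "K = M S" by blast
    then show "A \<subseteq> K \<and> r ^ 3 \<in> K \<and> maximal_avoiding r K"
      using M[of S] by (simp add: twist_def)
  qed
qed



section \<open>Cardinalities and Cantor sets\<close>

lemma lepoll_iff_ordLeq: "lepoll A B \<longleftrightarrow> ordLeq3 (card_of A) (card_of B)"
  by (simp add: lepoll_def card_of_ordLeq)

lemma not_lepoll_iff_ordLess: "\<not> lepoll B A \<longleftrightarrow> ordLess2 (card_of A) (card_of B)"
  using not_ordLeq_iff_ordLess[OF card_of_Well_order card_of_Well_order, of B A]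
  by (simp add: lepoll_iff_ordLeq)

lemma UN_lepoll:
  assumes "infinite B" "lepoll I B" "\<And>i. i \<in> I \<Longrightarrow> lepoll (A i) B"
  shows "lepoll (\<Union>i\<in>I. A i) B"
  using card_of_UNION_ordLeq_infinite[of B I A] assms by (simp add: lepoll_iff_ordLeq)

lemma countable_lepoll_infinite:
  assumes "countable A" "infinite B"
  shows "lepoll A B"
proof -
  have "lepoll A (UNIV :: nat set)"
    using assms(1) unfolding countable_def lepoll_def by auto
  then show ?thesis
    using assms(2) lepoll_trans infinite_le_lepoll by blast
qed

lemma lists_lepoll:
  assumes B: "infinite B" and A: "lepoll A B"
  shows "lepoll (lists A) B"
proof -
  have "lepoll {xs \<in> lists A. length xs = n} B" for n
  proof (induction n)
    case 0
    have "{xs \<in> lists A. length xs = 0} \<subseteq> {[]}" by auto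
    then have "countable {xs \<in> lists A. length xs = 0}" by (rule countable_subset) simp
    then show ?case by (rule countable_lepoll_infinite[OF _ B])
  next
    case (Suc n)
    have "{xs \<in> lists A. length xs = Suc n} \<subseteq> (\<Union>a\<in>A. (\<lambda>xs. a # xs) ` {xs \<in> lists A. length xs = n})"
    proof
      fix xs assume "xs \<in> {xs \<in> lists A. length xs = Suc n}"
      then obtain a ys where "xs = a # ys" "a \<in> A" "ys \<in> {xs \<in> lists A. length xs = n}"
        by (cases xs) auto
      then show "xs \<in> (\<Union>a\<in>A. (\<lambda>xs. a # xs) ` {xs \<in> lists A. length xs = n})" by blast
    qed
    moreover have "lepoll (\<Union>a\<in>A. (\<lambda>xs. a # xs) ` {xs \<in> lists A. length xs = n}) B"
      by (rule UN_lepoll[OF B A]) (rule lepoll_trans[OF image_lepoll Suc])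
    ultimately show ?case by (rule lepoll_trans[OF subset_imp_lepoll])
  qed
  then have "lepoll (\<Union>n. {xs \<in> lists A. length xs = n}) B"
    by (intro UN_lepoll B) (auto intro: countable_lepoll_infinite[OF _ B])
  moreover have "lists A = (\<Union>n. {xs \<in> lists A. length xs = n})" by auto
  ultimately show ?thesis by simp
qed

text \<open>An expression over \<open>A\<close> is an expression over the natural numbers together
  with a list in \<open>A\<close> that names its variables; there are only countably many of the
  former.\<close>

lemma pexpr_lepoll:
  fixes B :: "'b set" and A :: "'a set"
  assumes B: "infinite B" and A: "lepoll A B"
  shows "lepoll {p. vars p \<subseteq> A} B"
proof -
  define F where "F xs = range (map_pexpr (nth xs))" for xs :: "'a list"
  let ?U = "\<Union>(F ` lists A)"
  have mem: "p \<in> ?U" if p: "vars p \<subseteq> A" for p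
  proof -
    obtain xs where xs: "set xs = vars p" using finite_list[OF finite_vars[of p]] ..
    define f where "f x = (SOME i. xs ! i = x)" for x
    have f: "xs ! f x = x" if "x \<in> vars p" for x
      unfolding f_def by (rule someI_ex) (use that xs in \<open>metis in_set_conv_nth\<close>)
    have "map_pexpr (nth xs) (map_pexpr f p) = map_pexpr (nth xs \<circ> f) p"
      by (rule pexpr.map_comp)
    also have "\<dots> = map_pexpr id p"
      by (rule pexpr.map_cong[OF refl]) (simp add: f)
    finally have "p = map_pexpr (nth xs) (map_pexpr f p)" by (simp only: pexpr.map_id)
    then have "p \<in> F xs" unfolding F_def by (rule image_eqI) (rule UNIV_I)
    moreover have "xs \<in> lists A" using xs p by (auto simp only: lists_eq_set)
    ultimately show ?thesis by (intro UN_I)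
  qed
  have "{p. vars p \<subseteq> A} \<subseteq> ?U" by (rule subsetI, rule mem, erule CollectD)
  moreover have "lepoll ?U B"
  proof (rule UN_lepoll[OF B lists_lepoll[OF B A]])
    show "lepoll (F xs) B" for xs
      unfolding F_def by (rule countable_lepoll_infinite[OF countable_image[OF countableI_type] B])
  qed
  ultimately show ?thesis by (rule lepoll_trans[OF subset_imp_lepoll])
qed

text \<open>An element that breaks independence is a root of a nonzero univariate polynomial with
  parameters from \<open>T\<close>, and there are at most as many expressions for such polynomials
  as elements of \<open>B\<close>.\<close>

lemma dependent_lepoll:
  fixes B :: "'b set"
  assumes T: "indep_set T" and B: "infinite B" and TB: "lepoll T B"
  shows "lepoll {x. \<not> indep_set (insert x T)} B"
proof -
  \<comment> \<open>\<open>None\<close> stands for the element \<open>x\<close>, so that one set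
    \<open>E\<close> serves all \<open>x\<close>.\<close>
  define E where "E = {p :: real option pexpr. vars p \<subseteq> insert None (Some ` T)}"
  define R where "R p = {y. ev (case_option y (\<lambda>x. x)) p = 0}" for p :: "real option pexpr"
  have "lepoll (insert None (Some ` T)) B"
  proof -
    have "lepoll (Some ` T) B" using lepoll_trans[OF image_lepoll TB] .
    then have "lepoll (\<Union>i\<in>UNIV. if i then {None} else Some ` T) B"
      by (intro UN_lepoll B) (auto intro: countable_lepoll_infinite[OF _ B])
    moreover have "(\<Union>i\<in>UNIV. if i then {None} else Some ` T) = insert None (Some ` T)"
      by (auto simp: UNIV_bool)
    ultimately show ?thesis by simp
  qed
  then have EB: "lepoll E B" unfolding E_def by (rule pexpr_lepoll[OF B])
  \<comment> \<open>An expression that vanishes for every value of \<open>None\<close> has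
    \<open>R p\<close> infinite; the conditional discards it.\<close>
  have "{x. \<not> indep_set (insert x T)} \<subseteq> (\<Union>p\<in>E. if finite (R p) then R p else {})"
  proof
    fix x assume "x \<in> {x. \<not> indep_set (insert x T)}"
    then obtain p where p: "vars p \<subseteq> insert x T" "nontrivial p" "ev (\<lambda>x. x) p = 0"
      unfolding indep_def by blast
    let ?q = "map_pexpr (\<lambda>y. if y = x then None else Some y) p"
    have "?q \<in> E" using p(1) by (auto simp: E_def pexpr.set_map)
    have ev: "ev (case_option y (\<lambda>x. x)) ?q = ev ((\<lambda>x. x)(x := y)) p" for y
      unfolding ev_map by (rule ev_cong) simp
    obtain P where P: "P \<noteq> 0" "\<And>y. ev ((\<lambda>x. x)(x := y)) p = poly P y"
      by (rule expand_at_indep[OF T p(1,2)]) (rule that)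
    have "R ?q = {y. poly P y = 0}" unfolding R_def ev P(2) ..
    then have "finite (R ?q)" using poly_roots_finite[OF P(1)] by simp
    moreover have "x \<in> R ?q" unfolding R_def ev using p(3) by (simp add: fun_upd_idem)
    ultimately show "x \<in> (\<Union>p\<in>E. if finite (R p) then R p else {})"
      using \<open>?q \<in> E\<close> by (intro UN_I[of ?q]) simp_all
  qed
  moreover have "lepoll (\<Union>p\<in>E. if finite (R p) then R p else {}) B"
    by (rule UN_lepoll[OF B EB]) (rule countable_lepoll_infinite[OF _ B], simp add: countable_finite)
  ultimately show ?thesis by (rule lepoll_trans[OF subset_imp_lepoll])
qed

section \<open>Cantor sets: size, translation, splitting and number\<close>

lemma cantor_set_lepoll:
  assumes "cantor_set C"
  shows "lepoll (UNIV :: real set) C"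
proof (rule lepoll_perfect_set)
  show "completely_metrizable_space (euclidean :: real topology) \<or>
      locally_compact_space (euclidean :: real topology) \<and> Hausdorff_space (euclidean :: real topology)"
    using completely_metrizable_space_euclidean by blast
  show "C \<noteq> {}" using assms by (simp add: cantor_set_def)
  have "closed C" using assms by (simp add: cantor_set_def compact_imp_closed)
  \<comment> \<open>Closed without isolated points means equal to the set of limit points, that is,
    perfect.\<close>
  then have "x islimpt C \<longleftrightarrow> x \<in> C" for x
    using assms unfolding cantor_set_def isolated_in_islimpt_iff closed_limpt by blast
  moreover have "euclidean derived_set_of C = {x. x islimpt C}"
    unfolding derived_set_of_def islimpt_def by auto
  ultimately show "euclidean derived_set_of C = C" by simp
qed

lemma cantor_set_translate:
  assumes "cantor_set C"
  shows "cantor_set ((+) a ` C)"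
  unfolding cantor_set_def
proof (intro conjI notI)
  note C = assms[unfolded cantor_set_def]
  show "(+) a ` C = {} \<Longrightarrow> False" using C by simp
  show "compact ((+) a ` C)" using C compact_translation by blast
  have mem: "x \<in> (+) a ` C \<longleftrightarrow> x - a \<in> C" for x by (auto simp: image_iff) (metis add.commute diff_add_cancel)
  show False if iv: "\<exists>x y. x < y \<and> {x..y} \<subseteq> (+) a ` C"
  proof -
    obtain x y where xy: "x < y" "{x..y} \<subseteq> (+) a ` C" using iv by blast
    have "z \<in> C" if "z \<in> {x - a..y - a}" for z
    proof -
      have "z + a \<in> {x..y}" using that by auto
      then have "z + a \<in> (+) a ` C" using xy(2) by blast
      then show ?thesis unfolding mem by simp
    qed
    then have "{x - a..y - a} \<subseteq> C" by blast
    moreover have "x - a < y - a" using xy(1) by simp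
    ultimately show False using C by blast
  qed
  show False if iso: "\<exists>x. x isolated_in (+) a ` C"
  proof -
    obtain x where x: "x isolated_in (+) a ` C" using iso by blast
    then obtain e where e: "x \<in> (+) a ` C" "e > 0" "\<And>y. y \<in> (+) a ` C \<Longrightarrow> dist x y < e \<Longrightarrow> y = x"
      unfolding isolated_in_dist_Ex_iff by blast
    have "(x - a) isolated_in C"
      unfolding isolated_in_dist_Ex_iff
    proof (intro conjI exI[of _ e] ballI impI)
      show "x - a \<in> C" using e(1) mem by simp
      fix y assume "y \<in> C" "dist (x - a) y < e"
      then show "y = x - a" using e(3)[of "a + y"] by (simp add: dist_real_def algebra_simps)
    qed (use e in simp)
    then show False using C by blast
  qed
qed

text \<open>\<open>S\<close> and \<open>S'\<close> cut the same relatively clopen piece from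
  \<open>C\<close>: closedness gives compactness, and by openness an isolated point of the piece
  would be isolated in \<open>C\<close>.\<close>

lemma cantor_set_clopen_part:
  assumes C: "cantor_set C" and S: "closed S" "open S'" "C \<inter> S = C \<inter> S'" "C \<inter> S \<noteq> {}"
  shows "cantor_set (C \<inter> S)"
  unfolding cantor_set_def
proof (intro conjI notI)
  show "compact (C \<inter> S)" using C S(1) by (simp add: cantor_set_def compact_Int_closed)
  show "C \<inter> S = {} \<Longrightarrow> False" using S(4) by simp
  show "\<exists>a b. a < b \<and> {a..b} \<subseteq> C \<inter> S \<Longrightarrow> False"
    using C unfolding cantor_set_def by blast
  show False if iso: "\<exists>x. x isolated_in C \<inter> S"
  proof -
    obtain x T where "x \<in> C \<inter> S" "open T" "T \<inter> (C \<inter> S) = {x}"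
      using iso unfolding isolated_in_def by blast
    then have "open (T \<inter> S')" "(T \<inter> S') \<inter> C = {x}" "x \<in> C" using S(2,3) by auto
    then have "x isolated_in C" unfolding isolated_in_def by blast
    then show False using C unfolding cantor_set_def by blast
  qed
qed

text \<open>\<open>C\<close> contains no interval, so some \<open>z\<close> between two of its
  points is missing; cutting at \<open>z\<close> yields two relatively clopen pieces.\<close>

lemma cantor_set_split:
  assumes C: "cantor_set C"
  obtains C1 C2 where "cantor_set C1" "cantor_set C2" "C1 \<inter> C2 = {}" "C1 \<subseteq> C" "C2 \<subseteq> C"
proof -
  have "infinite C"
    using cantor_set_lepoll[OF C] infinite_UNIV_char_0 by (metis finite_lepoll_infinite lepoll_trans infinite_le_lepoll)
  then obtain u where u: "u \<in> C" by (metis ex_in_conv finite.emptyI)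
  have "infinite (C - {u})" using \<open>infinite C\<close> by simp
  then obtain v where v: "v \<in> C" "v \<noteq> u" by (metis Diff_iff ex_in_conv finite.emptyI insertI1)
  obtain x y where xy: "x \<in> C" "y \<in> C" "x < y"
    using u v by (cases "u < v") (auto simp: not_less less_le)
  obtain z where z: "z \<in> {x..y}" "z \<notin> C" using xy(3) C unfolding cantor_set_def by blast
  have "z \<noteq> x" "z \<noteq> y" using z(2) xy by auto
  then have xzy: "x < z" "z < y" using z(1) by auto
  have "cantor_set (C \<inter> {..z})"
    by (rule cantor_set_clopen_part[OF C, of _ "{..<z}"]) (use z xy xzy in \<open>auto simp: order.order_iff_strict\<close>)
  moreover have "cantor_set (C \<inter> {z..})"
    by (rule cantor_set_clopen_part[OF C, of _ "{z<..}"]) (use z xy xzy in \<open>auto simp: order.order_iff_strict\<close>)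
  moreover have "(C \<inter> {..z}) \<inter> (C \<inter> {z..}) = {}" using z(2) by (auto intro: order.antisym)
  ultimately show thesis using that[of "C \<inter> {..z}" "C \<inter> {z..}"] by blast
qed

text \<open>A closed set is determined by the members of a countable basis that miss it.\<close>

lemma cantor_sets_lepoll: "lepoll {C. cantor_set C} (UNIV :: real set)"
proof -
  obtain \<B> :: "real set set" where \<B>: "countable \<B>" "topological_basis \<B>"
    using ex_countable_basis by blast
  have "inj_on (\<lambda>C. {b \<in> \<B>. b \<subseteq> - C}) {C. cantor_set C}"
  proof (rule inj_onI)
    have eq: "- C = \<Union>{b \<in> \<B>. b \<subseteq> - C}" if "cantor_set C" for C
    proof -
      have "open (- C)" using that by (simp add: cantor_set_def compact_imp_closed open_Compl)
      then obtain \<B>' where "\<B>' \<subseteq> \<B>" "\<Union>\<B>' = - C" using \<B>(2) unfolding topological_basis_def by metis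
      then show ?thesis by blast
    qed
    fix C C' assume "C \<in> {C. cantor_set C}" "C' \<in> {C. cantor_set C}" "{b \<in> \<B>. b \<subseteq> - C} = {b \<in> \<B>. b \<subseteq> - C'}"
    then have "- C = - C'" using eq[of C] eq[of C'] by simp
    then show "C = C'" by simp
  qed
  then have "lepoll {C. cantor_set C} (Pow \<B>)"
    unfolding lepoll_def by (intro exI conjI) (assumption, blast)
  also have "lepoll (Pow \<B>) (UNIV :: nat set set)"
    unfolding lepoll_def
  proof (intro exI conjI)
    show "inj_on (\<lambda>S. to_nat_on \<B> ` S) (Pow \<B>)"
      using inj_on_to_nat_on[OF \<B>(1)] by (intro inj_on_image) simp
  qed simp
  also have "eqpoll (UNIV :: nat set set) (UNIV :: real set)" by (rule nat_sets_eqpoll_reals)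
  finally show ?thesis .
qed

lemma bernstein_setI:
  assumes K: "real_subfield K" "K \<noteq> UNIV" and meets: "\<And>C. cantor_set C \<Longrightarrow> K \<inter> C \<noteq> {}"
  shows "bernstein_set K"
  unfolding bernstein_set_def
proof (intro conjI notI)
  show False if sub: "\<exists>C. cantor_set C \<and> C \<subseteq> K"
  proof -
    obtain C where C: "cantor_set C" "C \<subseteq> K" using sub by blast
    obtain a where "a \<notin> K" using K(2) by blast
    obtain x where "x \<in> K" "x \<in> (+) a ` C"
      using meets[OF cantor_set_translate[OF C(1)]] by blast
    then obtain c where "c \<in> C" "a = x - c" by auto
    then have "a \<in> K" using real_subfield_diff[OF K(1) \<open>x \<in> K\<close>] C(2) by blast
    then show False using \<open>a \<notin> K\<close> by blast
  qed
  show False if "\<exists>C. cantor_set C \<and> C \<subseteq> - K"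
    using that meets by blast
qed



section \<open>An algebraically independent Cantor set\<close>

text \<open>Continuity of evaluation, by contradiction along the radii \<open>1 / (n + 1)\<close>.
  The filter form lets several smallness conditions be met by one radius.\<close>

lemma ev_nonzero_nearby:
  assumes "ev f p \<noteq> 0"
  shows "\<forall>\<^sub>F \<delta> in at_right (0 :: real). \<forall>w. (\<forall>i\<in>vars p. \<bar>w i - f i\<bar> \<le> \<delta>) \<longrightarrow> ev w p \<noteq> 0"
proof -
  have "\<exists>\<delta>>0. \<forall>w. (\<forall>i\<in>vars p. \<bar>w i - f i\<bar> \<le> \<delta>) \<longrightarrow> ev w p \<noteq> 0"
  proof (rule ccontr)
    assume "\<not> ?thesis"
    then have "\<forall>n. \<exists>w. (\<forall>i\<in>vars p. \<bar>w i - f i\<bar> \<le> inverse (real (Suc n))) \<and> ev w p = 0"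
      by (metis inverse_positive_iff_positive of_nat_0_less_iff zero_less_Suc)
    then obtain w where w: "\<And>n i. i \<in> vars p \<Longrightarrow> \<bar>w n i - f i\<bar> \<le> inverse (real (Suc n))"
        "\<And>n. ev (w n) p = 0"
      by metis
    have "(\<lambda>n. w n i) \<longlonglongrightarrow> f i" if "i \<in> vars p" for i
    proof (rule LIM_zero_cancel, rule Lim_null_comparison)
      show "\<forall>\<^sub>F n in sequentially. norm (w n i - f i) \<le> inverse (real (Suc n))"
        using w(1)[OF that] by simp
    qed (rule LIMSEQ_inverse_real_of_nat)
    then have "(\<lambda>n. ev (w n) p) \<longlonglongrightarrow> ev f p"
      by (rule tendsto_ev)
    then show False
      using assms by (simp add: w(2) LIMSEQ_const_iff)
  qed
  then obtain \<delta> where "\<delta> > 0" and \<delta>: "\<And>w. (\<And>i. i \<in> vars p \<Longrightarrow> \<bar>w i - f i\<bar> \<le> \<delta>) \<Longrightarrow> ev w p \<noteq> 0"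
    by metis
  then show ?thesis
    unfolding eventually_at_right_field
    by (intro exI[of _ \<delta>] conjI allI impI) (auto intro!: \<delta> dest!: bspec)
qed

text \<open>Only countably many reals are dependent on a finite independent set, while a ball is
  uncountable.\<close>

lemma indep_extend_in_ball:
  assumes "indep_set T" "finite T" "e > 0"
  obtains x where "x \<in> ball d e" "x \<notin> T" "indep_set (insert x T)"
proof -
  have "lepoll {x. \<not> indep_set (insert x T)} (UNIV :: nat set)"
    by (rule dependent_lepoll[OF assms(1)]) (simp_all add: countable_lepoll_infinite countable_finite assms(2))
  then have "countable {x. \<not> indep_set (insert x T)}"
    by (rule countable_lepoll[rotated]) simp
  then have "countable ({x. \<not> indep_set (insert x T)} \<union> T)"
    using assms(2) by (simp add: countable_finite)
  then have "\<not> ball d e \<subseteq> {x. \<not> indep_set (insert x T)} \<union> T"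
    using uncountable_ball[OF assms(3)] countable_subset by metis
  then show thesis using that by auto
qed

lemma indep_empty: "indep_set {}"
  unfolding indep_def nontrivial_def
proof (intro allI impI)
  fix p :: "real pexpr" assume "vars p \<subseteq> {}" "\<exists>v. ev v p \<noteq> 0"
  then obtain v where "ev v p \<noteq> 0" by blast
  moreover have "ev v p = ev (\<lambda>x. x) p" by (rule ev_cong) (use \<open>vars p \<subseteq> {}\<close> in auto)
  ultimately show "ev (\<lambda>x. x) p \<noteq> 0" by simp
qed

text \<open>The induction adds two fresh points per centre. Having two of them prevents isolated
  points in the limit set.\<close>

lemma indep_two_in_each_ball:
  assumes "finite D" "e > 0"
  shows "\<exists>T. finite T \<and> indep_set T \<and> T \<subseteq> (\<Union>d\<in>D. ball d e) \<and>
           (\<forall>d\<in>D. \<exists>x\<in>T. \<exists>y\<in>T. x \<noteq> y \<and> x \<in> ball d e \<and> y \<in> ball d e)"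
  using assms(1)
proof (induction D)
  case empty
  show ?case by (rule exI[of _ "{}"]) (simp add: indep_empty)
next
  case (insert d D)
  then obtain T where T: "finite T" "indep_set T" "T \<subseteq> (\<Union>d\<in>D. ball d e)"
     "\<forall>d\<in>D. \<exists>x\<in>T. \<exists>y\<in>T. x \<noteq> y \<and> x \<in> ball d e \<and> y \<in> ball d e"
    by (elim exE conjE)
  obtain x where x: "x \<in> ball d e" "x \<notin> T" "indep_set (insert x T)"
    by (rule indep_extend_in_ball[OF T(2,1) assms(2)])
  obtain y where y: "y \<in> ball d e" "y \<notin> insert x T" "indep_set (insert y (insert x T))"
    by (rule indep_extend_in_ball[OF x(3) _ assms(2)]) (simp add: T(1))
  let ?T = "insert y (insert x T)"
  have "\<exists>x\<in>?T. \<exists>y\<in>?T. x \<noteq> y \<and> x \<in> ball d' e \<and> y \<in> ball d' e" if "d' \<in> insert d D" for d'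
  proof (cases "d' = d")
    case True
    show ?thesis by (rule bexI[of _ x], rule bexI[of _ y]) (use x y True in auto)
  next
    case False
    then have "\<exists>x\<in>T. \<exists>y\<in>T. x \<noteq> y \<and> x \<in> ball d' e \<and> y \<in> ball d' e" using T(4) that by simp
    then obtain a b where "a \<in> T" "b \<in> T" "a \<noteq> b \<and> a \<in> ball d' e \<and> b \<in> ball d' e" by (elim bexE)
    then show ?thesis by (intro bexI[of _ a] bexI[of _ b]) simp_all
  qed
  moreover have "?T \<subseteq> (\<Union>d\<in>insert d D. ball d e)" using T(3) x(1) y(1) by auto
  ultimately show ?case using T(1) y(3) by (intro exI[of _ ?T]) simp
qed

lemma eventually_separated:
  fixes T :: "real set"
  assumes "finite T"
  shows "\<forall>\<^sub>F \<delta> in at_right 0. \<forall>x\<in>T. \<forall>y\<in>T. x \<noteq> y \<longrightarrow> 2 * \<delta> < \<bar>x - y\<bar>"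
proof (intro eventually_ball_finite assms ballI)
  fix x y :: real
  show "\<forall>\<^sub>F \<delta> in at_right 0. x \<noteq> y \<longrightarrow> 2 * \<delta> < \<bar>x - y\<bar>"
    unfolding eventually_at_right_field
    by (intro exI[of _ "if x = y then 1 else \<bar>x - y\<bar> / 2"]) simp
qed

text \<open>The intervals of a stage are the balls \<open>cball d e\<close> with
  \<open>d \<in> D\<close>; the separation makes them disjoint. The map \<open>f\<close> sends the
  variables to distinct intervals, and \<open>w\<close> takes points from these.\<close>

definition stage :: "real set \<Rightarrow> real \<Rightarrow> nat pexpr \<Rightarrow> bool" where
  "stage D e p \<longleftrightarrow> finite D \<and> D \<noteq> {} \<and> e > 0 \<and> (\<forall>x\<in>D. \<forall>y\<in>D. x \<noteq> y \<longrightarrow> 2 * e < \<bar>x - y\<bar>) \<and>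
     (nontrivial p \<longrightarrow> (\<forall>f w. inj_on f (vars p) \<longrightarrow> f ` vars p \<subseteq> D \<longrightarrow>
        (\<forall>i\<in>vars p. \<bar>w i - f i\<bar> \<le> e) \<longrightarrow> ev w p \<noteq> 0))"

text \<open>Halving makes the radii tend to 0, containment makes the unions of intervals nested, and
  two subintervals in every interval exclude isolated points.\<close>

definition refines :: "real set \<Rightarrow> real \<Rightarrow> real set \<Rightarrow> real \<Rightarrow> bool" where
  "refines D' e' D e \<longleftrightarrow> e' \<le> e / 2 \<and> (\<forall>x\<in>D'. \<exists>d\<in>D. cball x e' \<subseteq> cball d e) \<and>
     (\<forall>d\<in>D. \<exists>x\<in>D'. \<exists>y\<in>D'. x \<noteq> y \<and> cball x e' \<subseteq> cball d e \<and> cball y e' \<subseteq> cball d e)"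

text \<open>With independent centres, a nontrivial \<open>p\<close> is nonzero at each of the
  finitely many injective assignments of centres to variables. All requirements on the radius then
  hold for every sufficiently small positive one.\<close>

lemma stage_exists:
  assumes D: "finite D" "D \<noteq> {}" "e > 0"
  shows "\<exists>D' e'. stage D' e' p \<and> refines D' e' D e"
proof -
  obtain T where T: "finite T" "indep_set T" "T \<subseteq> (\<Union>d\<in>D. ball d e)"
    "\<forall>d\<in>D. \<exists>x\<in>T. \<exists>y\<in>T. x \<noteq> y \<and> x \<in> ball d e \<and> y \<in> ball d e"
    using indep_two_in_each_ball[OF D(1,3)] by (elim exE conjE)
  \<comment> \<open>Extensional functions, so that the set is finite.\<close>
  let ?F = "{f \<in> vars p \<rightarrow>\<^sub>E T. inj_on f (vars p)}"
  have F: "finite ?F" using T(1) by (simp add: finite_PiE)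
  have ev1: "\<forall>\<^sub>F \<delta> in at_right (0::real). \<forall>f\<in>?F. nontrivial p \<longrightarrow>
      (\<forall>w. (\<forall>i\<in>vars p. \<bar>w i - f i\<bar> \<le> \<delta>) \<longrightarrow> ev w p \<noteq> 0)"
  proof (rule eventually_ball_finite[OF F], rule ballI)
    fix f assume f: "f \<in> ?F"
    show "\<forall>\<^sub>F \<delta> in at_right (0::real). nontrivial p \<longrightarrow>
      (\<forall>w. (\<forall>i\<in>vars p. \<bar>w i - f i\<bar> \<le> \<delta>) \<longrightarrow> ev w p \<noteq> 0)"
    proof (cases "nontrivial p")
      case True
      have "indep f (vars p)"
        using indep_reindex[OF T(2), of f "vars p"] f by (auto simp: PiE_def Pi_def)
      then have "ev f p \<noteq> 0" using True by (simp add: indep_def)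
      then show ?thesis using ev_nonzero_nearby[of f p] True by simp
    qed simp
  qed
  have ev2: "\<forall>\<^sub>F \<delta> in at_right (0::real). \<forall>x\<in>T. \<forall>y\<in>T. x \<noteq> y \<longrightarrow> 2 * \<delta> < \<bar>x - y\<bar>"
    by (rule eventually_separated[OF T(1)])
  have ev3: "\<forall>\<^sub>F \<delta> in at_right (0::real). \<forall>d\<in>D. \<forall>x\<in>T. x \<in> ball d e \<longrightarrow> cball x \<delta> \<subseteq> cball d e"
  proof (intro eventually_ball_finite T(1) D(1) ballI)
    fix d x
    show "\<forall>\<^sub>F \<delta> in at_right 0. x \<in> ball d e \<longrightarrow> cball x \<delta> \<subseteq> cball d e"
    proof (cases "x \<in> ball d e")
      case True
      have "cball x \<delta> \<subseteq> cball d e" if "\<delta> < e - dist d x" for \<delta>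
      proof
        fix y assume "y \<in> cball x \<delta>"
        then show "y \<in> cball d e" using that dist_triangle[of d y x] by simp
      qed
      moreover have "0 < e - dist d x" using True by simp
      ultimately show ?thesis
        unfolding eventually_at_right_field by (intro exI[of _ "e - dist d x"]) simp
    qed simp
  qed
  have ev4: "\<forall>\<^sub>F \<delta> in at_right (0::real). 0 < \<delta> \<and> \<delta> \<le> e / 2"
    unfolding eventually_at_right_field using D(3) by (intro exI[of _ "e / 2"]) simp
  have "\<forall>\<^sub>F \<delta> in at_right (0::real). (\<forall>f\<in>?F. nontrivial p \<longrightarrow>
      (\<forall>w. (\<forall>i\<in>vars p. \<bar>w i - f i\<bar> \<le> \<delta>) \<longrightarrow> ev w p \<noteq> 0)) \<and>
      (\<forall>x\<in>T. \<forall>y\<in>T. x \<noteq> y \<longrightarrow> 2 * \<delta> < \<bar>x - y\<bar>) \<and>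
      (\<forall>d\<in>D. \<forall>x\<in>T. x \<in> ball d e \<longrightarrow> cball x \<delta> \<subseteq> cball d e) \<and> (0 < \<delta> \<and> \<delta> \<le> e / 2)"
    by (intro eventually_conj ev1 ev2 ev3 ev4)
  then obtain \<delta> where \<delta>: "\<forall>f\<in>?F. nontrivial p \<longrightarrow>
      (\<forall>w. (\<forall>i\<in>vars p. \<bar>w i - f i\<bar> \<le> \<delta>) \<longrightarrow> ev w p \<noteq> 0)"
      "\<forall>x\<in>T. \<forall>y\<in>T. x \<noteq> y \<longrightarrow> 2 * \<delta> < \<bar>x - y\<bar>"
      "\<forall>d\<in>D. \<forall>x\<in>T. x \<in> ball d e \<longrightarrow> cball x \<delta> \<subseteq> cball d e" "0 < \<delta>" "\<delta> \<le> e / 2"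
    by (elim exE[OF eventually_happens'[OF trivial_limit_at_right_real]] conjE)
  have "stage T \<delta> p"
    unfolding stage_def
  proof (intro conjI impI allI)
    show "finite T" "\<delta> > 0" by fact+
    show "T \<noteq> {}" using T(4) D(2) by auto
    show "\<forall>x\<in>T. \<forall>y\<in>T. x \<noteq> y \<longrightarrow> 2 * \<delta> < \<bar>x - y\<bar>" by fact
    fix f w assume p: "nontrivial p" and f: "inj_on f (vars p)" "f ` vars p \<subseteq> T"
      and w: "\<forall>i\<in>vars p. \<bar>w i - f i\<bar> \<le> \<delta>"
    have "restrict f (vars p) \<in> ?F" using f by (auto simp: inj_on_restrict_eq)
    then have "\<forall>w. (\<forall>i\<in>vars p. \<bar>w i - restrict f (vars p) i\<bar> \<le> \<delta>) \<longrightarrow> ev w p \<noteq> 0"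
      using \<delta>(1) p by blast
    then show "ev w p \<noteq> 0" using w by simp
  qed
  moreover have "refines T \<delta> D e"
    unfolding refines_def
  proof (intro conjI ballI)
    show "\<delta> \<le> e / 2" by fact
    show "\<exists>d\<in>D. cball x \<delta> \<subseteq> cball d e" if x: "x \<in> T" for x
    proof -
      obtain d where "d \<in> D" "x \<in> ball d e" using T(3) x by blast
      then show ?thesis using \<delta>(3) x by (intro bexI[of _ d]) simp_all
    qed
    fix d assume d: "d \<in> D"
    then have "\<exists>x\<in>T. \<exists>y\<in>T. x \<noteq> y \<and> x \<in> ball d e \<and> y \<in> ball d e" using T(4) by simp
    then obtain x y where "x \<in> T" "y \<in> T" "x \<noteq> y \<and> x \<in> ball d e \<and> y \<in> ball d e"
      by (elim bexE)
    then show "\<exists>x\<in>T. \<exists>y\<in>T. x \<noteq> y \<and> cball x \<delta> \<subseteq> cball d e \<and> cball y \<delta> \<subseteq> cball d e"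
      using \<delta>(3) d by (intro bexI[of _ x] bexI[of _ y]) simp_all
  qed
  ultimately show ?thesis by (intro exI conjI)
qed

text \<open>Fusion: at stage \<open>n\<close> finitely many disjoint intervals are chosen such that the \<open>n\<close>-th
  polynomial does not vanish at points taken from distinct intervals. Every polynomial occurs
  infinitely often in the enumeration, in particular at stages fine enough to separate any
  given finite set of points.\<close>

lemma indep_cantor_set:
  obtains C where "cantor_set C" "indep_set C"
proof -
  \<comment> \<open>The second component of the decoded pair is ignored, which makes each expression
    recur.\<close>
  define q :: "nat \<Rightarrow> nat pexpr" where "q n = from_nat (fst (prod_decode n))" for n
  have "\<exists>s. \<forall>n. stage (fst (s n)) (snd (s n)) (q n) \<and>
      refines (fst (s (Suc n))) (snd (s (Suc n))) (fst (s n)) (snd (s n))"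
  proof (rule dependent_nat_choice)
    obtain D e where "stage D e (q 0)"
      using stage_exists[of "{0}" 1 "q 0"] by auto
    then show "\<exists>x. stage (fst x) (snd x) (q 0)" by (intro exI[of _ "(D, e)"]) simp
    fix s :: "real set \<times> real" and n assume "stage (fst s) (snd s) (q n)"
    then have "finite (fst s)" "fst s \<noteq> {}" "snd s > 0" by (simp_all add: stage_def)
    from stage_exists[OF this, of "q (Suc n)"]
    obtain D e where "stage D e (q (Suc n))" "refines D e (fst s) (snd s)" by (elim exE conjE)
    then show "\<exists>y. stage (fst y) (snd y) (q (Suc n)) \<and> refines (fst y) (snd y) (fst s) (snd s)"
      by (intro exI[of _ "(D, e)"]) simp
  qed
  then obtain s where s: "\<And>n. stage (fst (s n)) (snd (s n)) (q n)"
      "\<And>n. refines (fst (s (Suc n))) (snd (s (Suc n))) (fst (s n)) (snd (s n))"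
    by metis
  define D where "D n = fst (s n)" for n
  define e where "e n = snd (s n)" for n
  have st: "stage (D n) (e n) (q n)" and re: "refines (D (Suc n)) (e (Suc n)) (D n) (e n)" for n
    using s by (simp_all add: D_def e_def)
  have finD: "finite (D n)" and neD: "D n \<noteq> {}" and e0: "e n > 0"
    and sep: "\<And>x y. x \<in> D n \<Longrightarrow> y \<in> D n \<Longrightarrow> x \<noteq> y \<Longrightarrow> 2 * e n < \<bar>x - y\<bar>" for n
    using st[of n] by (simp_all add: stage_def)
  define U where "U n = (\<Union>d\<in>D n. cball d (e n))" for n
  have Usub: "U (Suc n) \<subseteq> U n" for n
    using re[of n] unfolding refines_def U_def by fastforce
  have Umono: "U n \<subseteq> U m" if "m \<le> n" for m n
    using that by (rule lift_Suc_antimono_le[of U, OF Usub])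
  have compU: "compact (U n)" for n
    unfolding U_def by (intro compact_UN finD) simp
  define C where "C = (\<Inter>n. U n)"
  have elim: "e n \<le> e 0 / 2 ^ n" for n
  proof (induction n)
    case (Suc n)
    have "e (Suc n) \<le> e n / 2" using re[of n] by (simp add: refines_def)
    also have "\<dots> \<le> e 0 / 2 ^ n / 2" using Suc by simp
    finally show ?case by (simp add: mult.commute)
  qed simp
  have "(\<lambda>n. e 0 / 2 ^ n) \<longlonglongrightarrow> 0"
    using LIMSEQ_divide_realpow_zero[of 2 "e 0"] by simp
  from tendsto_sandwich[OF _ _ tendsto_const this, of e]
  have e_lim: "e \<longlonglongrightarrow> 0"
    using elim e0 by (auto intro!: always_eventually less_imp_le)
  have small: "\<exists>N. \<forall>n\<ge>N. e n < \<delta>" if "\<delta> > 0" for \<delta>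
    using order_tendstoD(2)[OF e_lim that] by (simp add: eventually_sequentially)
  \<comment> \<open>A chosen interval contains intervals of every later stage, so it meets every
    \<open>U m\<close>, and compactness gives a point of \<open>C\<close> in it.\<close>
  have meet: "cball d (e n) \<inter> C \<noteq> {}" if d: "d \<in> D n" for d n
  proof -
    have chain: "\<exists>d'\<in>D (n + m). cball d' (e (n + m)) \<subseteq> cball d (e n)" for m
    proof (induction m)
      case 0
      show ?case using d by (intro bexI[of _ d]) simp_all
    next
      case (Suc m)
      then obtain d' where d': "d' \<in> D (n + m)" "cball d' (e (n + m)) \<subseteq> cball d (e n)" by (elim bexE)
      obtain x where "x \<in> D (Suc (n + m))" "cball x (e (Suc (n + m))) \<subseteq> cball d' (e (n + m))"
        using re[of "n + m"] d'(1) unfolding refines_def by blast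
      then show ?case using d'(2) by (intro bexI[of _ x]) auto
    qed
    have ne: "cball d (e n) \<inter> U m \<noteq> {}" for m
    proof -
      obtain d' where d': "d' \<in> D (n + m)" "cball d' (e (n + m)) \<subseteq> cball d (e n)"
        using chain[of m] by (elim bexE)
      have "d' \<in> cball d' (e (n + m))" using e0[of "n + m"] by simp
      moreover have "d' \<in> U (n + m)" unfolding U_def using d'(1) calculation by blast
      moreover have "U (n + m) \<subseteq> U m" by (rule Umono) simp
      ultimately show ?thesis using d'(2) by blast
    qed
    have "\<Inter>(range (\<lambda>m. cball d (e n) \<inter> U m)) \<noteq> {}"
    proof (rule compact_nest)
      show "compact (cball d (e n) \<inter> U m)" for m using compU by (intro compact_Int) simp_all
      show "cball d (e n) \<inter> U k \<subseteq> cball d (e n) \<inter> U m" if "m \<le> k" for m k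
        using Umono[OF that] by blast
    qed (rule ne)
    then show ?thesis unfolding C_def by auto
  qed
  have indC: "indep_set C"
    unfolding indep_def
  proof (intro allI impI)
    fix p :: "real pexpr" assume p: "vars p \<subseteq> C" "nontrivial p"
    \<comment> \<open>The enumeration ranges over expressions in natural numbers; \<open>h\<close>
      renames the variables of \<open>p\<close> accordingly, and \<open>?g\<close> undoes
      this.\<close>
    define h where "h = to_nat_on (vars p)"
    have h: "inj_on h (vars p)" unfolding h_def by (rule inj_on_to_nat_on) (simp add: countable_finite)
    let ?g = "inv_into (vars p) h"
    have gh: "?g (h x) = x" if "x \<in> vars p" for x using h that by simp
    let ?q = "map_pexpr h p"
    have vq: "vars ?q = h ` vars p" by (simp add: pexpr.set_map)
    have evq: "ev (\<lambda>i. v (?g i)) ?q = ev v p" for v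
      unfolding ev_map by (rule ev_cong) (simp add: gh)
    have nq: "nontrivial ?q" using p(2) evq unfolding nontrivial_def by metis
    have "\<forall>\<^sub>F \<delta> in at_right (0::real). \<forall>x\<in>vars p. \<forall>y\<in>vars p. x \<noteq> y \<longrightarrow> 2 * \<delta> < \<bar>x - y\<bar>"
      by (rule eventually_separated[OF finite_vars])
    then obtain b where b: "b > 0" "\<And>\<delta>. \<delta> > 0 \<Longrightarrow> \<delta> < b \<Longrightarrow> \<forall>x\<in>vars p. \<forall>y\<in>vars p. x \<noteq> y \<longrightarrow> 2 * \<delta> < \<bar>x - y\<bar>"
      unfolding eventually_at_right_field by blast
    obtain N where N: "\<And>n. n \<ge> N \<Longrightarrow> e n < b" using small[OF b(1)] by blast
    \<comment> \<open>A stage that treats \<open>?q\<close> and, being at least \<open>N\<close>, is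
      fine enough to separate the variables of \<open>p\<close>.\<close>
    define n where "n = prod_encode (to_nat ?q, N)"
    have "n \<ge> N" unfolding n_def by (rule le_prod_encode_2)
    have qn: "q n = ?q" unfolding q_def n_def by simp
    have sepp: "\<forall>x\<in>vars p. \<forall>y\<in>vars p. x \<noteq> y \<longrightarrow> 2 * e n < \<bar>x - y\<bar>"
      using b(2)[OF e0 N[OF \<open>n \<ge> N\<close>]] .
    have "\<exists>d. d \<in> D n \<and> \<bar>x - d\<bar> \<le> e n" if "x \<in> vars p" for x
    proof -
      have "x \<in> U n" using p(1) that unfolding C_def by blast
      then show ?thesis unfolding U_def by (auto simp: dist_real_def abs_minus_commute)
    qed
    then obtain f where f: "\<And>x. x \<in> vars p \<Longrightarrow> f x \<in> D n" "\<And>x. x \<in> vars p \<Longrightarrow> \<bar>x - f x\<bar> \<le> e n"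
      by metis
    \<comment> \<open>Two points with the same centre would be at distance at most
      \<open>2 * e n\<close>.\<close>
    have injf: "inj_on f (vars p)"
    proof (rule inj_onI, rule ccontr)
      fix x y assume xy: "x \<in> vars p" "y \<in> vars p" "f x = f y" "x \<noteq> y"
      then have "2 * e n < \<bar>x - y\<bar>" using sepp by blast
      moreover have "\<bar>x - f x\<bar> \<le> e n" "\<bar>y - f x\<bar> \<le> e n" using f(2)[OF xy(1)] f(2)[OF xy(2)] xy(3) by simp_all
      ultimately show False by linarith
    qed
    have "\<forall>f w. inj_on f (vars ?q) \<longrightarrow> f ` vars ?q \<subseteq> D n \<longrightarrow>
        (\<forall>i\<in>vars ?q. \<bar>w i - f i\<bar> \<le> e n) \<longrightarrow> ev w ?q \<noteq> 0"
      using st[of n] nq unfolding stage_def qn by simp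
    then have "inj_on (\<lambda>i. f (?g i)) (vars ?q) \<longrightarrow> (\<lambda>i. f (?g i)) ` vars ?q \<subseteq> D n \<longrightarrow>
        (\<forall>i\<in>vars ?q. \<bar>?g i - f (?g i)\<bar> \<le> e n) \<longrightarrow> ev ?g ?q \<noteq> 0"
      by (elim allE)
    moreover have "inj_on (\<lambda>i. f (?g i)) (vars ?q)"
      unfolding vq using injf gh by (auto simp: inj_on_def)
    moreover have "(\<lambda>i. f (?g i)) ` vars ?q \<subseteq> D n" unfolding vq using f(1) gh by auto
    moreover have "\<forall>i\<in>vars ?q. \<bar>?g i - f (?g i)\<bar> \<le> e n" unfolding vq using f(2) gh by auto
    ultimately have "ev ?g ?q \<noteq> 0" by blast
    then show "ev (\<lambda>x. x) p \<noteq> 0" using evq[of "\<lambda>x. x"] by simp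
  qed
  have "cantor_set C"
    unfolding cantor_set_def
  proof (intro conjI notI)
    obtain d where "d \<in> D 0" using neD[of 0] by blast
    from meet[OF this] show "C = {} \<Longrightarrow> False" by blast
    show "compact C" unfolding C_def by (rule compact_Inter) (use compU in auto)
    \<comment> \<open>An interval would contain a rational, which satisfies a nontrivial linear
      relation.\<close>
    show False if iv: "\<exists>a b. a < b \<and> {a..b} \<subseteq> C"
    proof -
      obtain a b where ab: "a < b" "{a..b} \<subseteq> C" using iv by blast
      obtain x where x: "x \<in> \<rat>" "a < x" "x < b" using Rats_dense_in_real[OF ab(1)] by blast
      then have "x \<in> C" using ab(2) by auto
      obtain k l where kl: "x = of_int k / of_int l" "l > 0" using x(1) by (metis Rats_cases')
      let ?p = "PSub (PMul (PConst l) (PVar x)) (PConst k)"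
      have "ev (\<lambda>x. x) ?p = 0" using kl by simp
      moreover have "ev (\<lambda>_. x + 1) ?p \<noteq> 0" using kl by (simp add: field_simps)
      then have "nontrivial ?p" unfolding nontrivial_def by (rule exI[of _ "\<lambda>_. x + 1"])
      ultimately show False using indep_ev_eq_0_iff[OF indC, of ?p] \<open>x \<in> C\<close> by simp
    qed
    \<comment> \<open>An isolated \<open>x\<close> lies in a chosen interval of length less than
      \<open>\<epsilon>\<close>. Both of its disjoint subintervals contain points of
      \<open>C\<close>, and each such point would have to be \<open>x\<close>.\<close>
    show False if iso: "\<exists>x. x isolated_in C"
    proof -
      obtain x \<epsilon> where x: "x \<in> C" "\<epsilon> > 0" "\<And>y. y \<in> C \<Longrightarrow> dist x y < \<epsilon> \<Longrightarrow> y = x"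
        using iso unfolding isolated_in_dist_Ex_iff by blast
      have "\<epsilon> / 2 > 0" using x(2) by simp
      then obtain n where n: "e n < \<epsilon> / 2" using small by blast
      obtain d where d: "d \<in> D n" "x \<in> cball d (e n)" using x(1) unfolding C_def U_def by blast
      obtain y z where yz: "y \<in> D (Suc n)" "z \<in> D (Suc n)" "y \<noteq> z"
        "cball y (e (Suc n)) \<subseteq> cball d (e n)" "cball z (e (Suc n)) \<subseteq> cball d (e n)"
        using re[of n] d(1) unfolding refines_def by blast
      have only: "x \<in> cball t (e (Suc n))" if t: "t \<in> D (Suc n)" "cball t (e (Suc n)) \<subseteq> cball d (e n)" for t
      proof -
        obtain u where u: "u \<in> cball t (e (Suc n))" "u \<in> C" using meet[OF t(1)] by blast
        have "u \<in> cball d (e n)" using u(1) t(2) by blast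
        then have "dist x u < \<epsilon>" using d(2) n dist_triangle2[of x u d] dist_commute[of d x] dist_commute[of d u] by simp
        then show ?thesis using x(3)[OF u(2)] u(1) by simp
      qed
      have "\<bar>y - z\<bar> \<le> 2 * e (Suc n)"
        using only[OF yz(1,4)] only[OF yz(2,5)] by (auto simp: dist_real_def)
      then show False using sep[OF yz(1-3)] by simp
    qed
  qed
  then show thesis using that indC by blast
qed



section \<open>An algebraically independent set meeting all Cantor sets\<close>

lemma infinite_if_lepoll_reals:
  assumes "lepoll (UNIV :: real set) A"
  shows "infinite A"
  using assms infinite_UNIV_char_0[where 'a = real] by (meson infinite_le_lepoll lepoll_trans)

lemma remove_eqpoll_reals:
  assumes "lepoll (UNIV :: real set) B"
  shows "eqpoll (B - {r :: real}) (UNIV :: real set)"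
proof (rule lepoll_antisym)
  show "lepoll (B - {r}) (UNIV :: real set)" by (rule subset_imp_lepoll) simp
  have "infinite (B - {r})" using infinite_if_lepoll_reals[OF assms] by simp
  then have "eqpoll (insert r (B - {r})) (B - {r})" by (rule infinite_insert_eqpoll)
  moreover have "lepoll B (insert r (B - {r}))" by (rule subset_imp_lepoll) blast
  ultimately show "lepoll (UNIV :: real set) (B - {r})"
    using assms by (meson eqpoll_imp_lepoll lepoll_trans)
qed

text \<open>The translates of a single Cantor set are told apart by their minima.\<close>

lemma cantor_sets_many: "lepoll (UNIV :: real set) {C. cantor_set C}"
proof -
  obtain C where C: "cantor_set C" by (rule indep_cantor_set)
  then obtain m where m: "m \<in> C" "\<And>x. x \<in> C \<Longrightarrow> m \<le> x"
    unfolding cantor_set_def using compact_attains_inf by metis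
  have "inj (\<lambda>a. (+) a ` C)"
  proof (rule injI)
    fix a b :: real assume eq: "(+) a ` C = (+) b ` C"
    have le: "c \<le> d" if "(+) c ` C = (+) d ` C" for c d
    proof -
      have "d + m \<in> (+) c ` C" using that m(1) by blast
      then obtain x where "x \<in> C" "d + m = c + x" by blast
      then show ?thesis using m(2)[of x] by linarith
    qed
    show "a = b" using le[OF eq] le[OF eq[symmetric]] by simp
  qed
  moreover have "range (\<lambda>a. (+) a ` C) \<subseteq> {C. cantor_set C}"
    using cantor_set_translate[OF C] by blast
  ultimately show ?thesis unfolding lepoll_def by blast
qed

text \<open>The indices of a finite subset have a last one \<open>m\<close> in the well-order, so
  the subset consists of \<open>f m\<close> and earlier values at most.\<close>

lemma indep_well_ordered:
  assumes wo: "Well_order r" and J: "J \<subseteq> Field r"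
    and step: "\<And>i. i \<in> J \<Longrightarrow> indep_set (insert (f i) (f ` underS r i))"
  shows "indep_set (f ` J)"
proof (rule indep_finite_char)
  fix F assume F: "finite F" "F \<subseteq> f ` J"
  obtain G where G: "G \<subseteq> J" "finite G" "F = f ` G"
    using finite_subset_image[OF F] by blast
  show "indep_set F"
  proof (cases "G = {}")
    case True
    then show ?thesis using G(3) indep_empty by simp
  next
    case False
    interpret W: wo_rel r by unfold_locales (rule wo)
    have "\<exists>m\<in>G. \<forall>i\<in>G. (i, m) \<in> r"
      using G(2) False G(1)
    proof (induction G rule: finite_ne_induct)
      case (singleton x)
      then have "(x, x) \<in> r" using J W.REFL by (auto simp: refl_on_def)
      then show ?case by simp
    next
      case (insert x G)
      then obtain m where m: "m \<in> G" "\<forall>i\<in>G. (i, m) \<in> r" by auto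
      have xm: "x \<in> Field r" "m \<in> Field r" using insert.prems J m(1) by auto
      show ?case
      proof (cases "(x, m) \<in> r")
        case True
        then show ?thesis using m by (intro bexI[of _ m]) auto
      next
        case False
        then have "(m, x) \<in> r" using W.TOTALS xm by blast
        moreover have "(x, x) \<in> r" using W.REFL xm(1) by (auto simp: refl_on_def)
        ultimately have "\<forall>i\<in>insert x G. (i, x) \<in> r"
          using m(2) W.TRANS unfolding trans_def by blast
        then show ?thesis by (intro bexI[of _ x]) simp_all
      qed
    qed
    then obtain m where m: "m \<in> G" "\<forall>i\<in>G. (i, m) \<in> r" by (elim bexE)
    have "G \<subseteq> insert m (underS r m)" using m(2) by (auto simp: underS_def)
    then have "F \<subseteq> insert (f m) (f ` underS r m)" using G(3) by blast
    moreover have "indep_set (insert (f m) (f ` underS r m))" using step m(1) G(1) by blast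
    ultimately show ?thesis by (rule indep_subset[rotated])
  qed
qed

text \<open>The choice is made by transfinite recursion along a well-order all of whose proper initial
  segments have size less than the continuum.\<close>

lemma indep_choice_function:
  fixes I :: "'i set" and S :: "'i \<Rightarrow> real set"
  assumes I: "lepoll I (UNIV :: real set)" and S: "\<And>i. i \<in> I \<Longrightarrow> lepoll (UNIV :: real set) (S i)"
  obtains f where "inj_on f I" "indep_set (f ` I)" "\<And>i. i \<in> I \<Longrightarrow> f i \<in> S i"
proof -
  define r where "r = card_of I"
  have wo: "Well_order r" and co: "Card_order r" and Fr: "Field r = I"
    unfolding r_def by (rule card_of_Well_order card_of_Card_order Field_card_of)+
  interpret W: wo_rel r by unfold_locales (rule wo)
  \<comment> \<open>\<open>y\<close> is an admissible value at \<open>i\<close> given the earlier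
    values of \<open>f\<close>. Indices outside \<open>I\<close> are unconstrained, which makes the
    recursion total.\<close>
  define P where "P f i y \<longleftrightarrow> (i \<in> I \<longrightarrow> y \<in> S i \<and> y \<notin> f ` underS r i \<and> indep_set (insert y (f ` underS r i)))"
    for f :: "'i \<Rightarrow> real" and i y
  have under: "j \<in> underS r i \<longleftrightarrow> (j, i) \<in> r - Id" for i j by (auto simp: underS_def)
  have "\<exists>f. \<forall>i. P f i (f i)"
  proof (rule dependent_wf_choice)
    show "wf (r - Id)" by (rule W.WF)
    show "P f i y = P g i y" if "\<And>z. (z, i) \<in> r - Id \<Longrightarrow> f z = g z" for f g :: "'i \<Rightarrow> real" and i y
    proof -
      have "f ` underS r i = g ` underS r i" using that under by (intro image_cong) auto
      then show ?thesis unfolding P_def by simp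
    qed
    fix i f assume IH: "\<And>j. (j, i) \<in> r - Id \<Longrightarrow> P f j (f j)"
    show "\<exists>y. P f i y"
    proof (cases "i \<in> I")
      case True
      let ?T = "f ` underS r i"
      have indT: "indep_set ?T"
      proof (rule indep_well_ordered[OF wo])
        show "underS r i \<subseteq> Field r" by (auto simp: underS_def Field_def)
        fix j assume j: "j \<in> underS r i"
        then have "j \<in> I" using Fr by (auto simp: underS_def Field_def)
        then show "indep_set (insert (f j) (f ` underS r j))"
          using IH[of j] j under unfolding P_def by blast
      qed
      have "ordLess2 (card_of (underS r i)) r"
        using card_of_underS[OF co] True Fr by simp
      then have "\<not> lepoll I (underS r i)"
        unfolding not_lepoll_iff_ordLess r_def .
      then have small: "\<not> lepoll (UNIV :: real set) (underS r i)"
        using lepoll_trans[OF I] by metis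
      have unc: "\<not> lepoll (UNIV :: real set) (UNIV :: nat set)"
      proof
        assume "lepoll (UNIV :: real set) (UNIV :: nat set)"
        from countable_lepoll[OF _ this] show False using uncountable_UNIV_real by simp
      qed
      \<comment> \<open>An infinite bound for the number of earlier values that is still below the
        continuum; the sum type offers the natural numbers in case there are only finitely
        many.\<close>
      obtain B :: "('i + nat) set" where B: "infinite B" "lepoll ?T B" "\<not> lepoll (UNIV :: real set) B"
      proof (cases "finite (underS r i)")
        case True
        let ?N = "range (Inr :: nat \<Rightarrow> 'i + nat)"
        have eq: "eqpoll ?N (UNIV :: nat set)" by (rule inj_on_image_eqpoll_self) simp
        have N: "infinite ?N" using eqpoll_finite_iff[OF eq] by simp
        show thesis
        proof (rule that[OF N])
          show "lepoll ?T ?N" by (rule countable_lepoll_infinite[OF _ N]) (simp add: True countable_finite)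
          show "\<not> lepoll (UNIV :: real set) ?N" using unc lepoll_trans2[OF _ eq] by metis
        qed
      next
        case False
        let ?N = "(Inl :: 'i \<Rightarrow> 'i + nat) ` underS r i"
        have eq: "eqpoll ?N (underS r i)" by (rule inj_on_image_eqpoll_self) simp
        show thesis
        proof (rule that)
          show "infinite ?N" using eqpoll_finite_iff[OF eq] False by simp
          show "lepoll ?T ?N" using lepoll_trans2[OF image_lepoll eqpoll_sym[OF eq]] .
          show "\<not> lepoll (UNIV :: real set) ?N" using small lepoll_trans2[OF _ eq] by metis
        qed
      qed
      \<comment> \<open>The forbidden values, dependent or already used, number fewer than the
        continuum, so \<open>S i\<close> has others.\<close>
      have "lepoll (\<Union>b\<in>UNIV. if b then {x. \<not> indep_set (insert x ?T)} else ?T) B"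
        by (rule UN_lepoll[OF B(1) countable_lepoll_infinite[OF _ B(1)]])
          (use dependent_lepoll[OF indT B(1,2)] B(2) in auto)
      moreover have "(\<Union>b\<in>UNIV. if b then {x. \<not> indep_set (insert x ?T)} else ?T) =
          {x. \<not> indep_set (insert x ?T)} \<union> ?T" by (auto simp: UNIV_bool)
      ultimately have "lepoll ({x. \<not> indep_set (insert x ?T)} \<union> ?T) B" by simp
      then have "\<not> lepoll (S i) ({x. \<not> indep_set (insert x ?T)} \<union> ?T)"
        using B(3) lepoll_trans[OF S[OF True]] lepoll_trans by metis
      then have "\<not> S i \<subseteq> {x. \<not> indep_set (insert x ?T)} \<union> ?T"
        using subset_imp_lepoll by metis
      then obtain y where "y \<in> S i" "indep_set (insert y ?T)" "y \<notin> ?T" by auto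
      then show ?thesis unfolding P_def by blast
    qed (simp add: P_def)
  qed
  then obtain f where f: "\<And>i. P f i (f i)" by blast
  show thesis
  proof (rule that[of f])
    show "indep_set (f ` I)"
      by (rule indep_well_ordered[OF wo]) (use f Fr in \<open>simp_all add: P_def\<close>)
    show "f i \<in> S i" if "i \<in> I" for i using f[of i] that by (simp add: P_def)
    show "inj_on f I"
    proof (rule inj_onI, rule ccontr)
      fix i j assume ij: "i \<in> I" "j \<in> I" "f i = f j" "i \<noteq> j"
      have "f a \<noteq> f b" if "a \<in> I" "b \<in> I" "a \<in> underS r b" for a b
      proof -
        have "f b \<notin> f ` underS r b" using f[of b] that(2) by (simp add: P_def)
        moreover have "f a \<in> f ` underS r b" using that(3) by (rule imageI)
        ultimately show ?thesis by metis
      qed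
      moreover have "i \<in> underS r j \<or> j \<in> underS r i"
        using W.TOTALS ij Fr by (auto simp: underS_def)
      ultimately show False using ij by metis
    qed
  qed
qed

text \<open>One half of a split independent Cantor set is \<open>A\<close>; the other supplies
  \<open>r\<close> and \<open>Y\<close>.\<close>

lemma indep_cantor_pair:
  obtains A Y r where "indep_set (insert r (A \<union> Y))" "A \<inter> Y = {}" "r \<notin> A \<union> Y"
    "lepoll (UNIV :: real set) A" "eqpoll Y (UNIV :: real set)" "cantor_set A"
proof -
  obtain C where C: "cantor_set C" "indep_set C" by (rule indep_cantor_set)
  obtain A B where AB: "cantor_set A" "cantor_set B" "A \<inter> B = {}" "A \<subseteq> C" "B \<subseteq> C"
    by (rule cantor_set_split[OF C(1)])
  obtain r where r: "r \<in> B" using AB(2) unfolding cantor_set_def by blast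
  show thesis
  proof (rule that[of r A "B - {r}"])
    show "indep_set (insert r (A \<union> (B - {r})))"
      by (rule indep_subset[OF C(2)]) (use AB r in auto)
  qed (use AB r cantor_set_lepoll remove_eqpoll_reals in auto)
qed

text \<open>Two points are chosen from each Cantor set, tagged by a truth value: those tagged
  \<open>True\<close> form \<open>A\<close>, which thereby meets every Cantor set, and the others
  supply \<open>r\<close> and \<open>Y\<close>.\<close>

lemma indep_bernstein_pair:
  obtains A Y r where "indep_set (insert r (A \<union> Y))" "A \<inter> Y = {}" "r \<notin> A \<union> Y"
    "lepoll (UNIV :: real set) A" "eqpoll Y (UNIV :: real set)" "\<And>C. cantor_set C \<Longrightarrow> A \<inter> C \<noteq> {}"
proof -
  define I where "I = {C. cantor_set C} \<times> (UNIV :: bool set)"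
  have inf: "infinite (UNIV :: real set)" by (rule infinite_UNIV_char_0)
  have "lepoll (\<Union>b\<in>(UNIV :: bool set). (\<lambda>C. (C, b)) ` {C. cantor_set C}) (UNIV :: real set)"
    by (rule UN_lepoll[OF inf countable_lepoll_infinite[OF _ inf]])
      (simp, rule lepoll_trans[OF image_lepoll cantor_sets_lepoll])
  moreover have "(\<Union>b\<in>UNIV. (\<lambda>C. (C, b)) ` {C. cantor_set C}) = I" by (auto simp: I_def)
  ultimately have I: "lepoll I (UNIV :: real set)" by simp
  obtain f where f: "inj_on f I" "indep_set (f ` I)" "\<And>i. i \<in> I \<Longrightarrow> f i \<in> fst i"
  proof (rule indep_choice_function[OF I, of fst])
    show "lepoll (UNIV :: real set) (fst i)" if "i \<in> I" for i
      using that cantor_set_lepoll by (auto simp: I_def)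
  qed (rule that)
  define A where "A = (\<lambda>C. f (C, True)) ` {C. cantor_set C}"
  define B where "B = (\<lambda>C. f (C, False)) ` {C. cantor_set C}"
  have "inj_on (\<lambda>C. f (C, b)) {C. cantor_set C}" for b
    using f(1) by (auto simp: inj_on_def I_def)
  then have "eqpoll {C. cantor_set C} ((\<lambda>C. f (C, b)) ` {C. cantor_set C})" for b
    by (intro eqpoll_sym[OF inj_on_image_eqpoll_self])
  then have many: "lepoll (UNIV :: real set) A" "lepoll (UNIV :: real set) B"
    unfolding A_def B_def by (auto intro: lepoll_trans2[OF cantor_sets_many])
  have disj: "A \<inter> B = {}" using f(1) by (auto simp: A_def B_def I_def inj_on_def)
  have sub: "A \<subseteq> f ` I" "B \<subseteq> f ` I" by (auto simp: A_def B_def I_def)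
  obtain r where r: "r \<in> B" using infinite_if_lepoll_reals[OF many(2)] by (metis ex_in_conv finite.emptyI)
  show thesis
  proof (rule that[of r A "B - {r}"])
    show "indep_set (insert r (A \<union> (B - {r})))"
      by (rule indep_subset[OF f(2)]) (use sub r in auto)
    show "A \<inter> C \<noteq> {}" if "cantor_set C" for C
      using f(3)[of "(C, True)"] that by (auto simp: A_def I_def)
  qed (use disj r many remove_eqpoll_reals in auto)
qed

text \<open>By rigidity an embedding is the inclusion, which reduces incomparability to comparing
  fields as sets.\<close>

lemma maximal_avoiding_embedding:
  assumes K: "maximal_avoiding r K" "r ^ 3 \<in> K" and M: "subfield M (real_ring\<lparr>carrier := L\<rparr>)"
    and iso: "isomorphic_fields K M"
  shows "K \<subseteq> L"
proof -
  have "M = K"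
    by (rule isomorphic_fields_square_root_closed[OF _ iso maximal_avoiding_sqrt[OF K]])
      (use K in \<open>simp_all add: maximal_avoiding_def\<close>)
  moreover have "M \<subseteq> L" using subfieldE(3)[OF M] by simp
  ultimately show ?thesis by simp
qed



section \<open>The four families\<close>

lemma proper_meets_cantor_sets:
  assumes "real_subfield K" "r \<notin> K" "A \<subseteq> K" "\<And>C. cantor_set C \<Longrightarrow> A \<inter> C \<noteq> {}"
  shows "bernstein_set K"
  by (rule bernstein_setI) (use assms in blast)+

lemma maximal_avoiding_eq:
  assumes "maximal_avoiding r K" "maximal_avoiding r L" "K \<subseteq> L"
  shows "K = L"
  using assms by (simp add: maximal_avoiding_def)

theorem theorem1:
  shows "\<exists>C1 C2 B1 B2 :: real set set.
    (\<forall>K \<in> C1 \<union> C2 \<union> B1 \<union> B2. subfield K real_ring \<and> alg_closure_in_complex K = UNIV) \<and>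
    C1 \<approx> Pow (UNIV :: real set) \<and>
    C2 \<approx> Pow (UNIV :: real set) \<and>
    B1 \<approx> Pow (UNIV :: real set) \<and>
    B2 \<approx> Pow (UNIV :: real set) \<and>
    (\<forall>K \<in> C1 \<union> C2. cantor_field K) \<and>
    (\<forall>K \<in> B1 \<union> B2. bernstein_field K) \<and>
    (\<forall>K \<in> C1 \<union> B1. \<forall>L \<in> C1 \<union> B1. isomorphic_fields K L) \<and>
    incomparable_fields (C2 \<union> B2)"
proof -
  obtain A Y r where ind: "indep_set (insert r (A \<union> Y))" and disj: "A \<inter> Y = {}" "r \<notin> A \<union> Y"
    and big: "lepoll (UNIV :: real set) A" "eqpoll Y (UNIV :: real set)" and A: "cantor_set A"
    by (rule indep_cantor_pair)
  obtain A' Y' r' where ind': "indep_set (insert r' (A' \<union> Y'))" and disj': "A' \<inter> Y' = {}" "r' \<notin> A' \<union> Y'"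
    and big': "lepoll (UNIV :: real set) A'" "eqpoll Y' (UNIV :: real set)"
    and A': "\<And>C. cantor_set C \<Longrightarrow> A' \<inter> C \<noteq> {}"
    by (rule indep_bernstein_pair) (rule that)
  obtain C1 C2 where C: "eqpoll C1 (Pow (UNIV :: real set))" "eqpoll C2 (Pow (UNIV :: real set))"
    and C1: "\<And>K. K \<in> C1 \<Longrightarrow> A \<subseteq> K \<and> r \<notin> K \<and> (\<exists>T. K = gen T \<and> indep_set T \<and> eqpoll T (UNIV :: real set)
       \<and> (\<forall>x. algebraic_over K x))"
    and C2: "\<And>K. K \<in> C2 \<Longrightarrow> A \<subseteq> K \<and> r ^ 3 \<in> K \<and> maximal_avoiding r K"
    by (rule twisted_families[OF ind disj big]) (rule that)
  obtain B1 B2 where B: "eqpoll B1 (Pow (UNIV :: real set))" "eqpoll B2 (Pow (UNIV :: real set))"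
    and B1: "\<And>K. K \<in> B1 \<Longrightarrow> A' \<subseteq> K \<and> r' \<notin> K \<and> (\<exists>T. K = gen T \<and> indep_set T \<and> eqpoll T (UNIV :: real set)
       \<and> (\<forall>x. algebraic_over K x))"
    and B2: "\<And>K. K \<in> B2 \<Longrightarrow> A' \<subseteq> K \<and> r' ^ 3 \<in> K \<and> maximal_avoiding r' K"
    by (rule twisted_families[OF ind' disj' big']) (rule that)
  have sfC: "real_subfield K" "r \<notin> K" "A \<subseteq> K" if "K \<in> C1 \<union> C2" for K
  proof -
    from that have "(real_subfield K \<and> r \<notin> K) \<and> A \<subseteq> K"
    proof
      assume "K \<in> C1"
      from C1[OF this] show ?thesis using real_subfield_gen by (elim conjE exE) simp
    next
      assume "K \<in> C2"
      from C2[OF this] show ?thesis by (simp add: maximal_avoiding_def)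
    qed
    then show "real_subfield K" "r \<notin> K" "A \<subseteq> K" by simp_all
  qed
  have sfB: "real_subfield K" "r' \<notin> K" "A' \<subseteq> K" if "K \<in> B1 \<union> B2" for K
  proof -
    from that have "(real_subfield K \<and> r' \<notin> K) \<and> A' \<subseteq> K"
    proof
      assume "K \<in> B1"
      from B1[OF this] show ?thesis using real_subfield_gen by (elim conjE exE) simp
    next
      assume "K \<in> B2"
      from B2[OF this] show ?thesis by (simp add: maximal_avoiding_def)
    qed
    then show "real_subfield K" "r' \<notin> K" "A' \<subseteq> K" by simp_all
  qed
  have alg: "algebraic_over K x" if "K \<in> C1 \<union> C2 \<union> B1 \<union> B2" for K x
    using that C1[of K] C2[of K] B1[of K] B2[of K] maximal_avoiding_algebraic by blast
  \<comment> \<open>The omitted element \<open>s\<close> is left free: fields in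
    \<open>B1 \<union> B2\<close> avoid \<open>r'\<close>, while the last case of the inclusion
    argument below uses \<open>r\<close>.\<close>
  have bern: "bernstein_set K" if "real_subfield K" "s \<notin> K" "A' \<subseteq> K" for K s
    using proper_meets_cantor_sets[OF that A'] .
  have cantorC: "cantor_field K" if "K \<in> C1 \<union> C2" for K
    unfolding cantor_field_def using sfC[OF that] A subfield_real_ring by blast
  have bernB: "bernstein_field K" if "K \<in> B1 \<union> B2" for K
    unfolding bernstein_field_def using sfB[OF that] bern subfield_real_ring by blast
  have all: "subfield K real_ring \<and> alg_closure_in_complex K = UNIV" if "K \<in> C1 \<union> C2 \<union> B1 \<union> B2" for K
  proof -
    have "real_subfield K" using that sfC(1)[of K] sfB(1)[of K] by auto
    then show ?thesis
      using subfield_real_ring alg_closure_in_complex_eq_UNIV[OF _ alg[OF that]] by simp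
  qed
  have iso: "isomorphic_fields K L" if "K \<in> C1 \<union> B1" "L \<in> C1 \<union> B1" for K L
  proof -
    have pure: "\<exists>T. F = gen T \<and> indep_set T \<and> eqpoll T (UNIV :: real set)" if "F \<in> C1 \<union> B1" for F
      using that C1[of F] B1[of F] by blast
    obtain T where T: "K = gen T" "indep_set T" "eqpoll T (UNIV :: real set)"
      using pure[OF \<open>K \<in> C1 \<union> B1\<close>] by (elim exE conjE)
    obtain T' where T': "L = gen T'" "indep_set T'" "eqpoll T' (UNIV :: real set)"
      using pure[OF \<open>L \<in> C1 \<union> B1\<close>] by (elim exE conjE)
    \<comment> \<open>Bases from both constructions have the size of the continuum, so Cantor and
      Bernstein fields are treated alike.\<close>
    have "eqpoll T T'" using T(3) eqpoll_sym[OF T'(3)] by (rule eqpoll_trans)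
    then obtain g where "bij_betw g T T'" unfolding eqpoll_def ..
    then show ?thesis unfolding T(1) T'(1) by (rule isomorphic_gen[OF T(2) T'(2)])
  qed
  have "K = L" if KL: "K \<in> C2 \<union> B2" "L \<in> C2 \<union> B2" "K \<subseteq> L" for K L
  proof -
    consider "K \<in> C2" "L \<in> C2" | "K \<in> B2" "L \<in> B2" | "K \<in> C2" "L \<in> B2" | "K \<in> B2" "L \<in> C2"
      using KL(1,2) by blast
    then show ?thesis
    proof cases
      case 1
      then show ?thesis using C2[of K] C2[of L] maximal_avoiding_eq[OF _ _ KL(3)] by metis
    next
      case 2
      then show ?thesis using B2[of K] B2[of L] maximal_avoiding_eq[OF _ _ KL(3)] by metis
    next
      case 3
      then have "A \<subseteq> L" using sfC(3)[of K] KL(3) by blast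
      moreover have "bernstein_set L" using bernB[of L] 3(2) by (simp add: bernstein_field_def)
      ultimately show ?thesis using A unfolding bernstein_set_def by blast
    next
      case 4
      then have "A' \<subseteq> L" using sfB(3)[of K] KL(3) by blast
      \<comment> \<open>As a proper subfield containing \<open>A'\<close>, the field
        \<open>L\<close> would be Bernstein, although it contains the Cantor set
        \<open>A\<close>.\<close>
      then have "bernstein_set L" using bern[of L r] sfC[of L] 4(2) by blast
      moreover have "A \<subseteq> L" using sfC(3)[of L] 4(2) by blast
      ultimately show ?thesis using A unfolding bernstein_set_def by blast
    qed
  qed
  moreover have "K \<subseteq> L" if K: "K \<in> C2 \<union> B2"
    and M: "subfield M (real_ring\<lparr>carrier := L\<rparr>)" "isomorphic_fields K M" for K L M
    using K
  proof
    assume "K \<in> C2"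
    from C2[OF this] show ?thesis using maximal_avoiding_embedding[of r K M L] M by simp
  next
    assume "K \<in> B2"
    from B2[OF this] show ?thesis using maximal_avoiding_embedding[of r' K M L] M by simp
  qed
  ultimately have inc: "incomparable_fields (C2 \<union> B2)"
    unfolding incomparable_fields_def by blast
  show ?thesis
  proof (rule exI[of _ C1], rule exI[of _ C2], rule exI[of _ B1], rule exI[of _ B2], intro conjI)
    show "\<forall>K \<in> C1 \<union> C2 \<union> B1 \<union> B2. subfield K real_ring \<and> alg_closure_in_complex K = UNIV"
      by (rule ballI) (rule all)
    show "\<forall>K \<in> C1 \<union> C2. cantor_field K" by (rule ballI) (rule cantorC)
    show "\<forall>K \<in> B1 \<union> B2. bernstein_field K" by (rule ballI) (rule bernB)
    show "\<forall>K \<in> C1 \<union> B1. \<forall>L \<in> C1 \<union> B1. isomorphic_fields K L" by (intro ballI) (rule iso)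
  qed (fact C B inc)+
qed

end
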